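(* Let $q>1$, let $V\in L^1_{loc}(\Omega\times[0,\infty))$ with $V>0$ a.e., and let $u_0\in L^1_{loc}(\Omega)$ with $u_0\ge 0$ a.e. Assume that there exists, for some $\varepsilon_0>0$, a nonincreasing function $f:(0,\varepsilon_0)\to[1,\infty)$ with $\lim_{\varepsilon\to 0^+}f(\varepsilon)=+\infty$ such that, for some $C>0$, for every $\varepsilon>0$ small enough $$\int_0^{f(\varepsilon)}\int_{\Omega_{\varepsilon/2}\setminus\Omega_{\varepsilon}}V^{-\frac{1}{q-1}}\,dx\,dt\le C\,\varepsilon^{\frac{2q}{q-1}},\qquad \int_{\frac12 f(\varepsilon)}^{f(\varepsilon)}\int_{\Omega_{\varepsilon/2}}V^{-\frac{1}{q-1}}\,dx\,dt\le C\,f(\varepsilon)^{\frac{q}{q-1}}.$$ If $u$ is a nonnegative weak solution of $$\begin{cases}\partial_t u-\Delta u=V u^q&\text{in }\Omega\times(0,+\infty),\\ u=0&\text{on }\partial\Omega\times(0,+\infty),\\ u=u_0&\text{in }\Omega\times\{0\},\end{cases}$$ then $u=0$ a.e. in $\Omega\times(0,+\infty)$.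
   Context: $\Omega\subset\mathbb{R}^N$, $N\ge 3$, is an open bounded connected set, $d(x):=\operatorname{dist}(x,\partial\Omega)$ for $x\in\overline\Omega$, and $\Omega_\varepsilon:=\{x\in\Omega: d(x)\ge\varepsilon\}$ for $\varepsilon>0$. Weak solution (the paper's definition of weak solution with $p=2$): a function $u\in W^{1,2}_{loc}(\Omega\times[0,+\infty))\cap L^q_{loc}(\Omega\times[0,+\infty),V\,dx\,dt)$ is a weak solution of the problem in the claim if $u\ge 0$ a.e. in $\Omega\times(0,+\infty)$ and for every $\varphi\in\operatorname{Lip}(\Omega\times[0,\infty))$ with $\varphi\ge 0$ and with compact support in $\Omega\times[0,\infty)$ one has $$\int_0^{\infty}\!\int_{\Omega}Vu^q\varphi\,dx\,dt\le\int_0^{\infty}\!\int_{\Omega}\langle\nabla u,\nabla\varphi\rangle\,dx\,dt-\int_0^{\infty}\!\int_{\Omega}u\,\partial_t\varphi\,dx\,dt-\int_{\Omega}u_0\,\varphi(x,0)\,dx.$$ Here $\nabla$ is the gradient in the $x$ variable. *)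

theory Defs
  imports "HOL-Analysis.Analysis"
begin

text \<open>
  Space-time points are pairs (x, t), so functions on
  \<open>\<Omega> \<times> [0, \<infinity>)\<close> have type \<open>'a \<times> real \<Rightarrow> _\<close>; all functions are total in HOL, and their
  values outside the domain in question play no role.  Integrals are taken with respect to
  the (complete) Lebesgue measure.
\<close>

subsection \<open>Local Lebesgue and Sobolev spaces\<close>

text \<open>The space L^p_loc(S, w dx). The set S need not be open: for
  \<open>S = \<Omega> \<times> [0, \<infinity>)\<close> the compact sets K may touch the face t = 0.\<close>

definition Lp_loc ::
    "real \<Rightarrow> 'b::euclidean_space set \<Rightarrow> ('b \<Rightarrow> real) \<Rightarrow> ('b \<Rightarrow> 'c::euclidean_space) set" where
  "Lp_loc p S w = {f. \<forall>K. compact K \<and> K \<subseteq> S \<longrightarrow>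
     f \<in> borel_measurable (lebesgue_on K) \<and>
     (\<lambda>x. norm (f x) powr p * w x) absolutely_integrable_on K}"

text \<open>Functions of class C^k on the whole space.\<close>

primrec Ck :: "nat \<Rightarrow> ('b::euclidean_space \<Rightarrow> real) \<Rightarrow> bool" where
  "Ck 0 f \<longleftrightarrow> continuous_on UNIV f"
| "Ck (Suc k) f \<longleftrightarrow> (\<forall>x. f differentiable (at x)) \<and>
     (\<forall>b\<in>Basis. Ck k (\<lambda>x. frechet_derivative f (at x) b))"

text \<open>C_c^\<open>\<infinity>\<close>(U) for open U, its elements being extended by zero.\<close>

definition test_functions :: "'b::euclidean_space set \<Rightarrow> ('b \<Rightarrow> real) set" where
  "test_functions U = {\<psi>. (\<forall>k. Ck k \<psi>) \<and> (\<exists>K. compact K \<and> K \<subseteq> U \<and> (\<forall>x. x \<notin> K \<longrightarrow> \<psi> x = 0))}"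

definition has_weak_gradient ::
    "'b::euclidean_space set \<Rightarrow> ('b \<Rightarrow> real) \<Rightarrow> ('b \<Rightarrow> 'b) \<Rightarrow> bool" where
  "has_weak_gradient U u G \<longleftrightarrow>
     u \<in> Lp_loc 1 U (\<lambda>_. 1) \<and> G \<in> Lp_loc 1 U (\<lambda>_. 1) \<and>
     (\<forall>\<psi>\<in>test_functions U. \<forall>b\<in>Basis.
        (LINT x:U|lebesgue. u x * frechet_derivative \<psi> (at x) b) =
        - (LINT x:U|lebesgue. (G x \<bullet> b) * \<psi> x))"

text \<open>W^{1,2}_loc(S), for S between an open set and its closure: the weak derivatives are
  taken in the interior of S, and square integrability is required on compact subsets of S.\<close>

definition W12_loc :: "'b::euclidean_space set \<Rightarrow> ('b \<Rightarrow> real) set" where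
  "W12_loc S = {u \<in> Lp_loc 2 S (\<lambda>_. 1).
     \<exists>G \<in> Lp_loc 2 S (\<lambda>_. 1). has_weak_gradient (interior S) u G}"

text \<open>For \<open>u \<in> W12_loc S\<close> the weak gradient is unique up to null sets; this picks a
  representative.\<close>

definition weak_grad :: "'b::euclidean_space set \<Rightarrow> ('b \<Rightarrow> real) \<Rightarrow> 'b \<Rightarrow> 'b" where
  "weak_grad S u = (SOME G. G \<in> Lp_loc 2 S (\<lambda>_. 1) \<and> has_weak_gradient (interior S) u G)"

subsection \<open>Weak solutions\<close>

text \<open>Classical derivatives in x and in t. They are applied to Lipschitz functions, for which
  they exist almost everywhere (Rademacher).\<close>

definition grad_x :: "('a::euclidean_space \<times> real \<Rightarrow> real) \<Rightarrow> 'a \<times> real \<Rightarrow> 'a" where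
  "grad_x \<phi> z = (THE D. GDERIV (\<lambda>y. \<phi> (y, snd z)) (fst z) :> D)"

definition deriv_t :: "('a::euclidean_space \<times> real \<Rightarrow> real) \<Rightarrow> 'a \<times> real \<Rightarrow> real" where
  "deriv_t \<phi> z = deriv (\<lambda>s. \<phi> (fst z, s)) (snd z)"

text \<open>Nonnegative functions in Lip(S) with compact support in S.\<close>

definition lip_test_functions :: "'b::euclidean_space set \<Rightarrow> ('b \<Rightarrow> real) set" where
  "lip_test_functions S = {\<phi>. (\<exists>L. L-lipschitz_on S \<phi>) \<and> (\<forall>z\<in>S. \<phi> z \<ge> 0) \<and>
     (\<exists>K. compact K \<and> K \<subseteq> S \<and> (\<forall>z\<in>S - K. \<phi> z = 0))}"

text \<open>Nonnegative weak solutions of \<open>\<partial>\<^sub>t u - \<Delta>u = V u\<^sup>q\<close> in \<open>\<Omega> \<times> (0, \<infinity>)\<close>, u = 0 on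
  \<open>\<partial>\<Omega> \<times> (0, \<infinity>)\<close>, \<open>u = u\<^sub>0\<close> at t = 0. The notion is an inequality and is local in \<open>\<Omega>\<close>; the
  lateral boundary condition does not enter it.
  The x-gradient of u is the first component of its weak space-time gradient.\<close>

definition weak_solution ::
    "'a::euclidean_space set \<Rightarrow> real \<Rightarrow> ('a \<times> real \<Rightarrow> real) \<Rightarrow> ('a \<Rightarrow> real) \<Rightarrow>
     ('a \<times> real \<Rightarrow> real) \<Rightarrow> bool" where
  "weak_solution \<Omega> q V u0 u \<longleftrightarrow>
     u \<in> W12_loc (\<Omega> \<times> {0..}) \<inter> Lp_loc q (\<Omega> \<times> {0..}) V \<and>
     (AE z in lebesgue. z \<in> \<Omega> \<times> {0<..} \<longrightarrow> u z \<ge> 0) \<and>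
     (\<forall>\<phi> \<in> lip_test_functions (\<Omega> \<times> {0..}).
        (LINT z:\<Omega> \<times> {0<..}|lebesgue. V z * u z powr q * \<phi> z)
        \<le> (LINT z:\<Omega> \<times> {0<..}|lebesgue. fst (weak_grad (\<Omega> \<times> {0..}) u z) \<bullet> grad_x \<phi> z)
          - (LINT z:\<Omega> \<times> {0<..}|lebesgue. u z * deriv_t \<phi> z)
          - (LINT x:\<Omega>|lebesgue. u0 x * \<phi> (x, 0)))"

definition inner_domain :: "'a::euclidean_space set \<Rightarrow> real \<Rightarrow> 'a set" where
  "inner_domain \<Omega> \<epsilon> = {x \<in> \<Omega>. infdist x (frontier \<Omega>) \<ge> \<epsilon>}"

end

theory Submission
  imports Defs
begin

text \<open>The inequality is tested with pure cutoff functions, without factors that depend on the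
  solution. The whole Laplacian can then be moved onto the cutoff, and only \<open>u\<close> itself has to be estimated.

  Let \<open>\<phi>(x, t) = g(x) h(t)\<close>, where \<open>g\<close> is 1 on \<open>\<Omega>\<^sub>\<epsilon>\<close> and vanishes outside \<open>\<Omega>\<^bsub>\<epsilon>/2\<^esub>\<close>, and \<open>h\<close> is 1 up to
  time \<open>f(\<epsilon>) / 2\<close> and vanishes after \<open>f(\<epsilon>)\<close>. Since \<open>u\<^sub>0 \<ge> 0\<close>, the weak formulation gives
  \<open>\<integral> V u\<^sup>q \<phi> \<le> \<integral> u (|\<Delta>g| h + g |h'|)\<close>. If \<open>g\<close> and \<open>h\<close> are high powers of smooth cutoffs with the natural
  scaling, then \<open>|\<Delta>g| h\<close> and \<open>g |h'|\<close> are at most a constant times \<open>\<epsilon>\<^bsup>-2\<^esup> \<phi>\<^bsup>1/q\<^esup>\<close> and \<open>f(\<epsilon>)\<^bsup>-1\<^esup> \<phi>\<^bsup>1/q\<^esup>\<close>, and they are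
  supported in \<open>(\<Omega>\<^bsub>\<epsilon>/2\<^esub> - \<Omega>\<^sub>\<epsilon>) \<times> (0, f(\<epsilon>))\<close> and in \<open>\<Omega>\<^bsub>\<epsilon>/2\<^esub> \<times> (f(\<epsilon>) / 2, f(\<epsilon>))\<close>. Young's inequality with
  weight \<open>\<mu>\<close> bounds the right hand side by \<open>2 \<mu>\<close> times the integral of \<open>V u\<^sup>q \<phi>\<close> over the union of these
  sets, plus \<open>\<mu>\<^bsup>-1/(q-1)\<^esup>\<close> times the integrals of \<open>V\<^bsup>-1/(q-1)\<^esup>\<close> over them. The hypotheses on \<open>V\<close> are scaled so
  that the last contribution is at most \<open>M \<mu>\<^bsup>-1/(q-1)\<^esup>\<close> with \<open>M\<close> independent of \<open>\<epsilon>\<close>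
  (\<open>test_function_estimate\<close>).

  For small \<open>\<mu>\<close> the first contribution is absorbed on the left, and \<open>\<epsilon> \<rightarrow> 0\<close> shows that the total energy
  \<open>\<integral> V u\<^sup>q\<close> is finite. Hence the energy in the supports of the derivatives tends to 0, because these sets
  leave every compact part of the cylinder; letting first \<open>\<epsilon> \<rightarrow> 0\<close> and then \<open>\<mu> \<rightarrow> \<infinity>\<close> shows that the total
  energy is 0 (\<open>vanishing_from_estimate\<close>). As \<open>V > 0\<close>, this forces \<open>u = 0\<close>.

  Two auxiliary facts carry the estimate. Cutoffs with second derivatives of order \<open>\<epsilon>\<^bsup>-2\<^esup>\<close> are obtained by
  mollifying functions of the distance (\<open>exists_cutoff\<close>). Moving the Laplacian onto the cutoff
  (\<open>weak_laplacian\<close>) needs care at \<open>t = 0\<close>, since weak derivatives are only tested with functions that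
  vanish near the initial time.\<close>

section \<open>Calculus of functions of class C^k\<close>

definition smooth :: "('b::euclidean_space \<Rightarrow> real) \<Rightarrow> bool" where
  "smooth f \<longleftrightarrow> (\<forall>k. Ck k f)"

abbreviation partial :: "'b::euclidean_space \<Rightarrow> ('b \<Rightarrow> real) \<Rightarrow> 'b \<Rightarrow> real" where
  "partial b f \<equiv> (\<lambda>x. frechet_derivative f (at x) b)"

text \<open>The predicate \<open>Ck\<close> is defined through the chosen derivative
  \<open>frechet_derivative\<close>; this rule lets any known derivative serve in its place, so that the
  closure properties below follow by induction from the usual differentiation rules.\<close>

lemma Ck_SucI:
  assumes "\<And>x. (f has_derivative f' x) (at x)" "\<And>b. b \<in> Basis \<Longrightarrow> Ck k (\<lambda>x. f' x b)"
  shows "Ck (Suc k) f"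
proof -
  have "frechet_derivative f (at x) = f' x" for x
    using frechet_derivative_at[OF assms(1)] by simp
  then show ?thesis using assms by (auto simp: differentiable_def)
qed

lemma Ck_Suc_derivative:
  "Ck (Suc k) f \<Longrightarrow> (f has_derivative frechet_derivative f (at x)) (at x)"
  by (simp add: frechet_derivative_works)

lemma Ck_continuous: "Ck k f \<Longrightarrow> continuous_on UNIV f"
  by (cases k)
    (auto intro!: differentiable_imp_continuous_on differentiable_at_imp_differentiable_on)

lemma Ck_SucD: "Ck (Suc k) f \<Longrightarrow> Ck k f"
proof (induction k arbitrary: f)
  case 0
  show ?case using Ck_continuous[OF 0] by simp
next
  case (Suc k)
  from Suc.prems[unfolded Ck.simps(2)[of "Suc k"]] have d: "\<forall>x. f differentiable at x"
    and "\<forall>b\<in>Basis. Ck (Suc k) (\<lambda>x. frechet_derivative f (at x) b)"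
    by blast+
  then have "\<forall>b\<in>Basis. Ck k (\<lambda>x. frechet_derivative f (at x) b)"
    using Suc.IH by blast
  with d show ?case by simp
qed

lemma Ck_const: "Ck k (\<lambda>x. c)"
proof (induction k arbitrary: c)
  case (Suc k)
  then show ?case by (intro Ck_SucI[where f'="\<lambda>x h. 0"]) auto
qed simp

lemma Ck_add: "Ck k f \<Longrightarrow> Ck k g \<Longrightarrow> Ck k (\<lambda>x. f x + g x)"
proof (induction k arbitrary: f g)
  case 0
  then show ?case by (auto intro: continuous_intros)
next
  case (Suc k)
  show ?case
    by (intro Ck_SucI[where f'="\<lambda>x h. frechet_derivative f (at x) h + frechet_derivative g (at x) h"]
        has_derivative_add Ck_Suc_derivative[OF Suc.prems(1)] Ck_Suc_derivative[OF Suc.prems(2)] Suc.IH)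
      (use Suc.prems in auto)
qed

lemma Ck_mult: "Ck k f \<Longrightarrow> Ck k g \<Longrightarrow> Ck k (\<lambda>x. f x * g x)"
proof (induction k arbitrary: f g)
  case 0
  then show ?case by (auto intro: continuous_intros)
next
  case (Suc k)
  show ?case
    by (intro Ck_SucI[where f'="\<lambda>x h. f x * frechet_derivative g (at x) h + frechet_derivative f (at x) h * g x"]
        has_derivative_mult Ck_Suc_derivative[OF Suc.prems(1)] Ck_Suc_derivative[OF Suc.prems(2)] Ck_add Suc.IH)
      (use Suc.prems Ck_SucD[OF Suc.prems(1)] Ck_SucD[OF Suc.prems(2)] in auto)
qed

lemma Ck_sum: "(\<And>i. i \<in> I \<Longrightarrow> Ck k (f i)) \<Longrightarrow> Ck k (\<lambda>x. \<Sum>i\<in>I. f i x)"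
  by (induction I rule: infinite_finite_induct) (auto intro: Ck_add Ck_const)

lemma Ck_power: "Ck k f \<Longrightarrow> Ck k (\<lambda>x. f x ^ n)"
  by (induction n) (auto intro: Ck_mult Ck_const)

text \<open>A directional derivative of the composition in direction \<open>b\<close> is the derivative
  of \<open>f\<close> in direction \<open>A b\<close>, which need not be a basis vector; it is expanded in the basis because
  only basis directions occur in \<open>Ck\<close>.\<close>

lemma Ck_compose_linear:
  fixes A :: "'a::euclidean_space \<Rightarrow> 'b::euclidean_space"
  assumes A: "bounded_linear A"
  shows "Ck k f \<Longrightarrow> Ck k (\<lambda>x. f (A x))"
proof (induction k arbitrary: f)
  case 0
  then show ?case
    using continuous_on_compose2[of UNIV f UNIV A] A linear_continuous_on[OF A] by auto
next
  case (Suc k)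
  have "linear (frechet_derivative f (at y))" for y
    using Ck_Suc_derivative[OF Suc.prems] has_derivative_bounded_linear bounded_linear.linear by blast
  then have lin: "frechet_derivative f (at y) v
      = (\<Sum>c\<in>Basis. (v \<bullet> c) * frechet_derivative f (at y) c)" for y v
    by (subst euclidean_representation[of v, symmetric])
       (simp add: linear_sum linear_cmul)
  show ?case
  proof (rule Ck_SucI[where f'="\<lambda>x h. \<Sum>c\<in>Basis. (A h \<bullet> c) * frechet_derivative f (at (A x)) c"])
    fix x
    have "((\<lambda>x. f (A x)) has_derivative (\<lambda>h. frechet_derivative f (at (A x)) (A h))) (at x)"
      using has_derivative_compose[OF bounded_linear_imp_has_derivative[OF A] Ck_Suc_derivative[OF Suc.prems]] .
    then show "((\<lambda>x. f (A x)) has_derivative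
        (\<lambda>h. \<Sum>c\<in>Basis. (A h \<bullet> c) * frechet_derivative f (at (A x)) c)) (at x)"
      by (simp only: lin[of "A x" "A _" for x])
  next
    fix b :: 'a
    have "Ck k (\<lambda>x. frechet_derivative f (at (A x)) c)" if "c \<in> Basis" for c
      by (rule Suc.IH) (use Suc.prems that in simp)
    then show "Ck k (\<lambda>x. \<Sum>c\<in>Basis. (A b \<bullet> c) * frechet_derivative f (at (A x)) c)"
      by (intro Ck_sum Ck_mult Ck_const)
  qed
qed

lemma Ck_linear: 
  fixes A :: "'a::euclidean_space \<Rightarrow> real"
  assumes A: "bounded_linear A" shows "Ck k A"
proof (cases k)
  case 0
  then show ?thesis using linear_continuous_on[OF A] by simp
next
  case (Suc m)
  then show ?thesis
    using Ck_SucI[of A "\<lambda>x. A", OF bounded_linear_imp_has_derivative[OF A] Ck_const] by simp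
qed

lemma Ck_compose_real:
  fixes f :: "'a::euclidean_space \<Rightarrow> real" and g :: "real \<Rightarrow> real"
  shows "Ck k g \<Longrightarrow> Ck k f \<Longrightarrow> Ck k (\<lambda>x. g (f x))"
proof (induction k arbitrary: g)
  case 0
  then show ?case
    using continuous_on_compose2[of UNIV g UNIV f] by auto
next
  case (Suc k)
  have lin: "frechet_derivative g (at y) v = v * frechet_derivative g (at y) 1" for y v
    using linear_cmul[OF bounded_linear.linear[OF has_derivative_bounded_linear[OF
      Ck_Suc_derivative[OF Suc.prems(1)]]], of y v 1] by simp
  show ?case
  proof (rule Ck_SucI[where f'="\<lambda>x h. frechet_derivative f (at x) h * frechet_derivative g (at (f x)) 1"])
    fix x
    have "((\<lambda>x. g (f x)) has_derivative (\<lambda>h. frechet_derivative g (at (f x)) (frechet_derivative f (at x) h))) (at x)"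
      using has_derivative_compose[OF Ck_Suc_derivative[OF Suc.prems(2)] Ck_Suc_derivative[OF Suc.prems(1)]] .
    then show "((\<lambda>x. g (f x)) has_derivative
        (\<lambda>h. frechet_derivative f (at x) h * frechet_derivative g (at (f x)) 1)) (at x)"
      by (simp only: lin[of "f x" "frechet_derivative f (at x) _"])
  next
    fix b :: 'a assume "b \<in> Basis"
    moreover have "Ck k (\<lambda>x. partial 1 g (f x))"
      by (rule Suc.IH) (use Suc.prems Ck_SucD[OF Suc.prems(2)] in auto)
    ultimately show "Ck k (\<lambda>x. partial b f x * partial 1 g (f x))"
      using Suc.prems(2) by (intro Ck_mult) auto
  qed
qed

lemma smooth_continuous: "smooth f \<Longrightarrow> continuous_on S f"
  unfolding smooth_def using Ck_continuous continuous_on_subset by blast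

lemma smooth_derivative: "smooth f \<Longrightarrow> (f has_derivative frechet_derivative f (at x)) (at x)"
  unfolding smooth_def using Ck_Suc_derivative by blast

lemma smooth_partial: "smooth f \<Longrightarrow> b \<in> Basis \<Longrightarrow> smooth (partial b f)"
  unfolding smooth_def
proof (intro allI)
  fix k assume "\<forall>k. Ck k f" "b \<in> Basis"
  then have "Ck (Suc k) f" by blast
  with \<open>b \<in> Basis\<close> show "Ck k (partial b f)" by simp
qed

lemma smooth_mult: "smooth f \<Longrightarrow> smooth g \<Longrightarrow> smooth (\<lambda>x. f x * g x)"
  by (simp add: smooth_def Ck_mult)

lemma partial_eqI: "(f has_derivative f') (at x) \<Longrightarrow> partial b f x = f' b"
  using frechet_derivative_at by metis

lemma partial_eq_0_on_open:
  assumes "open S" "x \<in> S" "\<And>y. y \<in> S \<Longrightarrow> f y = c"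
  shows "partial b f x = 0"
  by (rule partial_eqI) (rule has_derivative_transform_within_open[OF has_derivative_const[of c] assms(1,2)], simp add: assms(3))

text \<open>The case \<open>n = 0\<close> is the classical function \<open>exp (- 1 / t)\<close> that is smooth
  but flat at 0. The factor \<open>t^{-n}\<close> makes the family closed under differentiation up to linear
  combinations, so that one induction settles all orders at once.\<close>

definition flat :: "nat \<Rightarrow> real \<Rightarrow> real" where
  "flat n t = (if t > 0 then (1 / t) ^ n * exp (- (1 / t)) else 0)"

lemma tendsto_power_exp_minus: "((\<lambda>s::real. s ^ n * exp (- s)) \<longlongrightarrow> 0) at_top"
  using tendsto_power_div_exp_0[of n] by (simp add: exp_minus field_simps)

lemma tendsto_flat_0: "(flat n \<longlongrightarrow> 0) (at 0)"
proof (rule filterlim_split_at)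
  show "(flat n \<longlongrightarrow> 0) (at_left 0)"
    by (rule tendsto_eventually) (auto simp: flat_def eventually_at_left_field intro!: exI[of _ "-1"])
  have "((\<lambda>t. (1 / t) ^ n * exp (- (1 / t))) \<longlongrightarrow> 0) (at_right (0::real))"
    using filterlim_compose[OF tendsto_power_exp_minus filterlim_inverse_at_top_right, of n]
    by (simp add: inverse_eq_divide)
  then show "(flat n \<longlongrightarrow> 0) (at_right 0)"
    by (rule Lim_transform_eventually)
      (auto simp: flat_def eventually_at_right_field intro!: exI[of _ "1"])
qed

text \<open>The only delicate point is \<open>t = 0\<close>, where the difference quotient of the
  \<open>n\<close>-th function is the \<open>(n+1)\<close>-st function of the family, which tends to 0.\<close>

lemma flat_has_derivative:
  "(flat n has_real_derivative (flat (n+2) t - of_nat n * flat (n+1) t)) (at t)"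
proof (cases t "0::real" rule: linorder_cases)
  case less
  have "(flat n has_real_derivative 0) (at t)"
    by (rule has_field_derivative_transform_within_open[OF DERIV_const, where S="{..<0}"])
      (use less in \<open>auto simp: flat_def\<close>)
  then show ?thesis using less by (simp add: flat_def)
next
  case greater
  have "((\<lambda>t. (1 / t) ^ n * exp (- (1 / t))) has_real_derivative
      (of_nat n * (- (1 / t)\<^sup>2 * (1 / t) ^ (n - Suc 0))) * exp (- (1 / t))
        + (1 / t) ^ n * (exp (- (1 / t)) * (1 / t)\<^sup>2)) (at t)"
    using greater by (auto intro!: derivative_eq_intros simp: power2_eq_square)
  moreover have "(of_nat n * (- (1 / t)\<^sup>2 * (1 / t) ^ (n - Suc 0))) * exp (- (1 / t))
        + (1 / t) ^ n * (exp (- (1 / t)) * (1 / t)\<^sup>2) = flat (n+2) t - of_nat n * flat (n+1) t"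
    using greater by (cases n) (auto simp: flat_def power2_eq_square algebra_simps)
  ultimately have "((\<lambda>t. (1 / t) ^ n * exp (- (1 / t))) has_real_derivative
      (flat (n+2) t - of_nat n * flat (n+1) t)) (at t)" by simp
  then show ?thesis
    by (rule has_field_derivative_transform_within_open[where S="{0<..}"])
      (use greater in \<open>auto simp: flat_def\<close>)
next
  case equal
  have "((\<lambda>y. (flat n y - flat n 0) / (y - 0)) \<longlongrightarrow> 0) (at 0)"
    by (rule Lim_transform_eventually[OF tendsto_flat_0[of "Suc n"]])
      (auto simp: flat_def eventually_at intro!: exI[of _ 1])
  then show ?thesis using equal by (simp add: has_field_derivative_iff flat_def)
qed

lemma Ck_flat: "Ck k (flat n)"
proof (induction k arbitrary: n)
  case 0
  show ?case
    using DERIV_isCont[OF flat_has_derivative] by (simp add: continuous_at_imp_continuous_on)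
next
  case (Suc k)
  show ?case
  proof (rule Ck_SucI)
    show "(flat n has_derivative (\<lambda>h. (flat (n+2) x - of_nat n * flat (n+1) x) * h)) (at x)" for x
      using flat_has_derivative by (simp add: has_field_derivative_def)
    have "Ck k (\<lambda>x. (flat (n+2) x + (- of_nat n) * flat (n+1) x) * b)" for b
      by (intro Ck_mult Ck_add Ck_const Suc.IH)
    then show "Ck k (\<lambda>x. (flat (n+2) x - of_nat n * flat (n+1) x) * b)" for b by simp
  qed
qed

lemma smooth_flat_compose: "smooth f \<Longrightarrow> smooth (\<lambda>x. flat 0 (f x))"
  by (simp add: smooth_def Ck_compose_real Ck_flat)

section \<open>Mollification\<close>

text \<open>A convolution, restricted to a box so that it is an integral of a continuous function
  over a compact set. The box is meant to contain the support of \<open>h\<close>, and \<open>\<rho>\<close> is the smoothing kernel.\<close>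

definition mollify :: "'b \<Rightarrow> 'b \<Rightarrow> ('b::euclidean_space \<Rightarrow> real) \<Rightarrow> ('b \<Rightarrow> real) \<Rightarrow> 'b \<Rightarrow> real" where
  "mollify l u h \<rho> z = integral (cbox l u) (\<lambda>y. h y * \<rho> (z - y))"

text \<open>Differentiation under the integral sign: all derivatives can be thrown on the
  kernel, so \<open>h\<close> has to be merely continuous. This is what makes the mollified function as smooth
  as the kernel.\<close>

lemma mollify_has_derivative:
  fixes \<rho> :: "'b::euclidean_space \<Rightarrow> real"
  assumes h: "continuous_on UNIV h" and \<rho>: "Ck 1 \<rho>"
  shows "(mollify l u h \<rho> has_derivative
    (\<lambda>v. \<Sum>b\<in>Basis. (v \<bullet> b) * mollify l u h (partial b \<rho>) z)) (at z)"
proof -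
  \<comment> \<open>The total derivative of the integrand in x, as a bounded linear functional depending continuously on (x, y).\<close>
  define F where "F = (\<lambda>x y. \<Sum>b\<in>Basis. (h y * partial b \<rho> (x - y)) *\<^sub>R blinfun_inner_left b)"
  have d: "(\<rho> has_derivative frechet_derivative \<rho> (at x)) (at x)" for x
    using \<rho> by (intro Ck_Suc_derivative[of 0]) simp
  have lin: "frechet_derivative \<rho> (at x) v = (\<Sum>b\<in>Basis. (v \<bullet> b) * partial b \<rho> x)" for x v
    using has_derivative_bounded_linear[OF d[of x]]
    by (subst euclidean_representation[of v, symmetric])
       (simp add: linear_sum linear_cmul bounded_linear.linear)
  have c0: "continuous_on UNIV (partial b \<rho>)" if "b \<in> Basis" for b
    using \<rho> that by simp
  have c1: "continuous_on S (\<lambda>p. partial b \<rho> (f p))" if "b \<in> Basis" "continuous_on S f"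
    for b S and f :: "'c::topological_space \<Rightarrow> 'b"
    using continuous_on_compose2[OF c0[OF that(1)] that(2)] by simp
  have ch: "continuous_on S (\<lambda>p. h (f p))" if "continuous_on S f" for S and f :: "'c::topological_space \<Rightarrow> 'b"
    using continuous_on_compose2[OF h that] by simp
  have cr: "continuous_on S (\<lambda>p. \<rho> (f p))" if "continuous_on S f" for S and f :: "'c::topological_space \<Rightarrow> 'b"
    using continuous_on_compose2[OF Ck_continuous[OF \<rho>] that] by simp
  have "((\<lambda>x. integral (cbox l u) ((\<lambda>x y. h y * \<rho> (x - y)) x)) has_derivative
      blinfun_apply (integral (cbox l u) (F z))) (at z within UNIV)"
  proof (rule leibniz_rule)
    fix x y
    have "((\<lambda>x. \<rho> (x - y)) has_derivative (\<lambda>v. frechet_derivative \<rho> (at (x - y)) v)) (at x)"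
      by (rule has_derivative_compose[OF _ d]) (auto intro!: derivative_eq_intros)
    then have "((\<lambda>x. h y * \<rho> (x - y)) has_derivative (\<lambda>v. h y * frechet_derivative \<rho> (at (x - y)) v)) (at x)"
      by (rule has_derivative_mult_right)
    moreover have "h y * frechet_derivative \<rho> (at (x - y)) v = blinfun_apply (F x y) v" for v
      by (subst lin) (simp add: F_def blinfun.sum_left blinfun.scaleR_left sum_distrib_left mult_ac)
    ultimately show "((\<lambda>x. h y * \<rho> (x - y)) has_derivative blinfun_apply (F x y)) (at x within UNIV)"
      by simp
  next
    show "(\<lambda>y. h y * \<rho> (x - y)) integrable_on cbox l u" for x
      by (intro integrable_continuous continuous_on_mult ch cr continuous_intros)
    show "continuous_on (UNIV \<times> cbox l u) (\<lambda>(x, y). F x y)"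
      unfolding F_def split_beta
      by (intro continuous_on_sum continuous_on_scaleR continuous_on_mult ch c1 continuous_intros)
  qed auto
  moreover have e: "blinfun_apply (integral (cbox l u) (F z)) v
      = (\<Sum>b\<in>Basis. (v \<bullet> b) * mollify l u h (partial b \<rho>) z)" for v
  proof -
    have i: "(\<lambda>y. h y * partial b \<rho> (z - y)) integrable_on cbox l u" if "b \<in> Basis" for b
      by (intro integrable_continuous continuous_on_mult ch c1 continuous_intros that)
    have "F z integrable_on cbox l u"
      unfolding F_def
      by (intro integrable_continuous continuous_on_sum continuous_on_scaleR continuous_on_mult ch c1 continuous_intros)
    then have "blinfun_apply (integral (cbox l u) (F z)) v = integral (cbox l u) (\<lambda>y. blinfun_apply (F z y) v)"
      by (rule blinfun_apply_integral)
    also have "\<dots> = integral (cbox l u) (\<lambda>y. \<Sum>b\<in>Basis. (v \<bullet> b) * (h y * partial b \<rho> (z - y)))"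
      by (simp add: F_def blinfun.sum_left blinfun.scaleR_left mult_ac)
    also have "\<dots> = (\<Sum>b\<in>Basis. (v \<bullet> b) * mollify l u h (partial b \<rho>) z)"
      using i by (subst integral_sum) (auto simp: mollify_def intro!: integrable_on_mult_right)
    finally show ?thesis .
  qed
  moreover from e have "blinfun_apply (integral (cbox l u) (F z))
      = (\<lambda>v. \<Sum>b\<in>Basis. (v \<bullet> b) * mollify l u h (partial b \<rho>) z)" by (rule ext)
  ultimately show ?thesis by (simp add: mollify_def[abs_def])
qed

lemma partial_mollify:
  assumes "continuous_on UNIV h" "Ck 1 \<rho>" "b \<in> Basis"
  shows "partial b (mollify l u h \<rho>) z = mollify l u h (partial b \<rho>) z"
proof -
  have "(\<Sum>c\<in>Basis. (b \<bullet> c) * mollify l u h (partial c \<rho>) z) = mollify l u h (partial b \<rho>) z"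
    using assms(3) by (simp add: inner_Basis if_distrib[of "\<lambda>x. x * _"] sum.delta cong: if_cong)
  then show ?thesis
    using partial_eqI[OF mollify_has_derivative[OF assms(1,2)]] by metis
qed

lemma smooth_mollify:
  assumes h: "continuous_on UNIV h"
  shows "smooth \<rho> \<Longrightarrow> smooth (mollify l u h \<rho>)"
  unfolding smooth_def
proof
  fix k assume "\<forall>k. Ck k \<rho>"
  then have "Ck (Suc k) \<rho>" by blast
  have "Ck (Suc k) \<rho> \<Longrightarrow> Ck k (mollify l u h \<rho>)" for k
  proof (induction k arbitrary: \<rho>)
    case 0
    have "continuous (at x) (mollify l u h \<rho>)" for x
      using has_derivative_continuous[OF mollify_has_derivative[OF h]] 0 by simp
    then show ?case by (simp add: continuous_at_imp_continuous_on)
  next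
    case (Suc k)
    have 1: "Ck 1 \<rho>" using Suc.prems Ck_continuous[of "Suc k" "partial _ \<rho>"] by simp
    show ?case
    proof (rule Ck_SucI)
      show "(mollify l u h \<rho> has_derivative
        (\<lambda>v. \<Sum>b\<in>Basis. (v \<bullet> b) * mollify l u h (partial b \<rho>) x)) (at x)" for x
        by (rule mollify_has_derivative[OF h 1])
      fix v
      have "Ck k (mollify l u h (partial b \<rho>))" if "b \<in> Basis" for b
        by (rule Suc.IH) (use Suc.prems that in auto)
      then have "Ck k (\<lambda>x. mollify l u h (partial b \<rho>) x)" if "b \<in> Basis" for b using that by blast
      then show "Ck k (\<lambda>x. \<Sum>b\<in>Basis. (v \<bullet> b) * mollify l u h (partial b \<rho>) x)"
        by (intro Ck_sum Ck_mult Ck_const) 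
    qed
  qed
  then show "Ck k (mollify l u h \<rho>)" using \<open>Ck (Suc k) \<rho>\<close> by blast
qed

text \<open>Lebesgue measure is invariant under \<open>y \<mapsto> z - y\<close>, so the mass of the shifted
  kernel does not depend on the point \<open>z\<close>.\<close>

lemma has_integral_reflect_translate:
  fixes F :: "'b::euclidean_space \<Rightarrow> real"
  assumes c: "continuous_on UNIV F" and s: "\<And>x. x \<notin> cbox (-One) One \<Longrightarrow> F x = 0"
  shows "((\<lambda>y. F (z - y)) has_integral integral (cbox (-One) One) F) UNIV"
proof -
  have "(F has_integral integral (cbox (-One) One) F) (cbox (-One) One)"
    using c by (intro integrable_integral integrable_continuous) (blast intro: continuous_on_subset)
  from has_integral_affinity[OF this, of "-1" z]
  have "((\<lambda>y. F (z - y)) has_integral integral (cbox (-One) One) F) ((\<lambda>x. z - x) ` cbox (-One) One)"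
    by simp
  then show ?thesis
  proof (rule has_integral_on_superset)
    fix x assume "x \<notin> (\<lambda>x. z - x) ` cbox (-One) One"
    then have "z - x \<notin> cbox (-One) One" by (auto simp: image_iff)
    then show "F (z - x) = 0" by (rule s)
  qed auto
qed

text \<open>The bound does not depend on \<open>h\<close>, \<open>z\<close> or the box. Applied to derivatives of the
  kernel it bounds derivatives of cutoff functions uniformly over all sets that are cut off.\<close>

lemma mollify_bound:
  fixes F :: "'b::euclidean_space \<Rightarrow> real"
  assumes c: "continuous_on UNIV F" and s: "\<And>x. x \<notin> cbox (-One) One \<Longrightarrow> F x = 0"
    and h: "continuous_on UNIV h" "\<And>y. \<bar>h y\<bar> \<le> 1"
  shows "\<bar>mollify l u h F z\<bar> \<le> integral (cbox (-One) One) (\<lambda>x. \<bar>F x\<bar>)"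
proof -
  have r: "((\<lambda>y. \<bar>F (z - y)\<bar>) has_integral integral (cbox (-One) One) (\<lambda>x. \<bar>F x\<bar>)) UNIV"
    by (rule has_integral_reflect_translate[of "\<lambda>x. \<bar>F x\<bar>"]) (auto intro!: continuous_intros c simp: s)
  have cF: "continuous_on S (\<lambda>y. F (z - y))" for S
    by (rule continuous_on_compose2[OF c]) (auto intro!: continuous_intros)
  have ch: "continuous_on S h" for S using h(1) continuous_on_subset by blast
  have i: "(\<lambda>y. \<bar>F (z - y)\<bar>) integrable_on cbox l u"
    by (intro integrable_continuous continuous_intros cF)
  have "norm (mollify l u h F z) \<le> integral (cbox l u) (\<lambda>y. \<bar>F (z - y)\<bar>)"
    unfolding mollify_def
  proof (rule integral_norm_bound_integral[OF _ i])
    show "(\<lambda>y. h y * F (z - y)) integrable_on cbox l u"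
      by (intro integrable_continuous continuous_on_mult cF ch)
    show "norm (h x * F (z - x)) \<le> \<bar>F (z - x)\<bar>" for x
      using mult_right_mono[OF h(2)[of x], of "\<bar>F (z - x)\<bar>"] by (simp add: abs_mult)
  qed
  also have "\<dots> \<le> integral UNIV (\<lambda>y. \<bar>F (z - y)\<bar>)"
    by (rule integral_subset_le[OF _ i]) (use r in auto)
  also have "\<dots> = integral (cbox (-One) One) (\<lambda>x. \<bar>F x\<bar>)"
    using r by (rule integral_unique)
  finally show ?thesis by simp
qed

text \<open>The function \<open>exp (- 1 / (1 - |x|\<^sup>2))\<close> on the unit ball, extended by 0.\<close>

lemma exists_positive_bump:
  "\<exists>\<rho> :: 'b::euclidean_space \<Rightarrow> real. smooth \<rho> \<and> (\<forall>x. 0 \<le> \<rho> x) \<and> (\<forall>x. norm x \<ge> 1 \<longrightarrow> \<rho> x = 0) \<and>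
     integral (cbox (-One) One) \<rho> > 0"
proof (intro exI conjI allI impI)
  define \<rho> where "\<rho> = (\<lambda>x::'b. flat 0 (1 + (-1) * (\<Sum>b\<in>Basis. (x \<bullet> b)^2)))"
  have "smooth (\<lambda>x::'b. 1 + (-1) * (\<Sum>b\<in>Basis. (x \<bullet> b)^2))"
    unfolding smooth_def
    by (intro allI Ck_add Ck_const Ck_mult Ck_sum Ck_power Ck_linear bounded_linear_inner_left)
  then show sm: "smooth \<rho>" unfolding \<rho>_def by (rule smooth_flat_compose)
  have eq: "\<rho> x = flat 0 (1 - norm x ^ 2)" for x
    by (simp add: \<rho>_def norm_eq_sqrt_inner euclidean_inner[of x x] power2_eq_square sum_nonneg)
  show nn: "0 \<le> \<rho> x" for x by (simp add: eq flat_def)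
  show "\<rho> x = 0" if "1 \<le> norm x" for x
    using one_le_power[OF that, of 2] unfolding eq flat_def by simp
  have c: "continuous_on S \<rho>" for S by (rule smooth_continuous[OF sm])
  have hi: "(\<rho> has_integral integral (cbox (-One) One) \<rho>) (cbox (-One) One)"
    using c by (intro integrable_integral integrable_continuous)
  have "0 \<le> integral (cbox (-One) One) \<rho>"
    using nn by (intro integral_nonneg has_integral_integrable[OF hi])
  moreover have "integral (cbox (-One) One) \<rho> \<noteq> 0"
  proof
    assume "integral (cbox (-One) One) \<rho> = 0"
    with hi have "(\<rho> has_integral 0) (cbox (-One) One)" by simp
    then have "\<rho> 0 = 0"
      by (rule has_integral_0_cbox_imp_0[rotated 2]) (auto simp: c nn mem_box box_ne_empty)
    then show False by (simp add: eq flat_def)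
  qed
  ultimately show "0 < integral (cbox (-One) One) \<rho>" by simp
qed

lemma exists_bump:
  "\<exists>\<rho> :: 'b::euclidean_space \<Rightarrow> real. smooth \<rho> \<and> (\<forall>x. 0 \<le> \<rho> x) \<and> (\<forall>x. norm x \<ge> 1 \<longrightarrow> \<rho> x = 0) \<and>
     integral (cbox (-One) One) \<rho> = 1"
proof -
  obtain \<rho> :: "'b \<Rightarrow> real" where \<rho>: "smooth \<rho>" "\<And>x. 0 \<le> \<rho> x" "\<And>x. norm x \<ge> 1 \<Longrightarrow> \<rho> x = 0"
    and pos: "integral (cbox (-One) One) \<rho> > 0" (is "?c > 0")
    using exists_positive_bump by blast
  show ?thesis
  proof (intro exI[of _ "\<lambda>x. inverse ?c * \<rho> x"] conjI allI impI)
    show "smooth (\<lambda>x. inverse ?c * \<rho> x)"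
      using \<rho>(1) by (simp only: smooth_def) (intro allI Ck_mult Ck_const, blast)
  qed (use \<rho> pos in auto)
qed

lemma norm_le_1_imp_in_cbox: "norm (x::'b::euclidean_space) \<le> 1 \<Longrightarrow> x \<in> cbox (-One) One"
  using Basis_le_norm[of _ x] by (fastforce simp: mem_box abs_le_iff)

section \<open>Cutoff functions with controlled derivatives\<close>

lemma le_infdist: "A \<noteq> {} \<Longrightarrow> (\<And>a. a \<in> A \<Longrightarrow> d \<le> dist x a) \<Longrightarrow> d \<le> infdist x A"
  by (simp add: infdist_notempty cINF_greatest)

text \<open>Mollify, with a kernel of mass 1 supported in the unit ball, a piecewise linear
  function of the distance to \<open>A\<close> that is 1 up to distance 1 and 0 from distance 2 on. The kernel
  sees distances at most 1, so the result is 1 on \<open>A\<close> and 0 from distance 3 on. The constant \<open>K\<close> is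
  chosen before \<open>A\<close>: this uniformity is what the rescaling below relies on. The distance function
  itself would not do, because its second derivatives are not controlled.\<close>

lemma exists_unit_cutoff:
  "\<exists>K\<ge>0. \<forall>A::'b::euclidean_space set. bounded A \<longrightarrow>
    (\<exists>\<theta>. smooth \<theta> \<and> (\<forall>x. 0 \<le> \<theta> x \<and> \<theta> x \<le> 1) \<and> (\<forall>x\<in>A. \<theta> x = 1) \<and>
      (\<forall>x. \<theta> x \<noteq> 0 \<longrightarrow> (\<exists>a\<in>A. dist a x < 3)) \<and>
      (\<forall>b\<in>Basis. \<forall>x. \<bar>partial b \<theta> x\<bar> \<le> K \<and> \<bar>partial b (partial b \<theta>) x\<bar> \<le> K))"
proof -
  obtain \<rho> :: "'b \<Rightarrow> real" where sm: "smooth \<rho>" and nn: "\<And>x. 0 \<le> \<rho> x"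
    and supp: "\<And>x. norm x \<ge> 1 \<Longrightarrow> \<rho> x = 0" and int1: "integral (cbox (-One) One) \<rho> = 1"
    using exists_bump by blast
  have C1: "Ck 1 \<rho>" and C1': "\<And>b. b \<in> Basis \<Longrightarrow> Ck 1 (partial b \<rho>)"
    using sm smooth_partial[OF sm] unfolding smooth_def by blast+
  define N where "N = (\<lambda>F::'b \<Rightarrow> real. integral (cbox (-One) One) (\<lambda>x. \<bar>F x\<bar>))"
  have s0: "\<rho> x = 0" if "x \<notin> cbox (-One) One" for x
    using that norm_le_1_imp_in_cbox[of x] supp[of x] by linarith
  have op: "open (- cbox (-One) (One::'b))" using closed_cbox by blast
  have s1: "partial b \<rho> x = 0" if "x \<notin> cbox (-One) One" for x b
    by (rule partial_eq_0_on_open[OF op]) (use that s0 in auto)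
  have s2: "partial b (partial b \<rho>) x = 0" if "x \<notin> cbox (-One) One" for x b
    by (rule partial_eq_0_on_open[OF op]) (use that s1 in auto)
  have cont: "continuous_on S \<rho>" "b \<in> Basis \<Longrightarrow> continuous_on S (partial b \<rho>)"
    "b \<in> Basis \<Longrightarrow> continuous_on S (partial b (partial b \<rho>))" for S b
    using sm smooth_partial smooth_continuous by blast+
  have N0: "N F \<ge> 0" if "continuous_on UNIV F" for F
    unfolding N_def using that 
    by (intro integral_nonneg integrable_continuous continuous_intros) (auto intro: continuous_on_subset)
  define K where "K = (\<Sum>b\<in>Basis. N (partial b \<rho>) + N (partial b (partial b \<rho>)))"
  have NK: "N (partial b \<rho>) \<le> K" "N (partial b (partial b \<rho>)) \<le> K" if "b \<in> Basis" for b
  proof -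
    have "N (partial b \<rho>) + N (partial b (partial b \<rho>)) \<le> K"
      unfolding K_def
      by (rule member_le_sum[OF that]) (auto intro!: add_nonneg_nonneg N0 cont)
    then show "N (partial b \<rho>) \<le> K" "N (partial b (partial b \<rho>)) \<le> K"
      using N0[OF cont(2)[OF that]] N0[OF cont(3)[OF that]] by linarith+
  qed
  show ?thesis
  proof (intro exI[of _ K] conjI allI impI)
    show "K \<ge> 0" unfolding K_def by (intro sum_nonneg add_nonneg_nonneg N0 cont)
    fix A :: "'b set" assume "bounded A"
    show "\<exists>\<theta>. smooth \<theta> \<and> (\<forall>x. 0 \<le> \<theta> x \<and> \<theta> x \<le> 1) \<and> (\<forall>x\<in>A. \<theta> x = 1) \<and>
      (\<forall>x. \<theta> x \<noteq> 0 \<longrightarrow> (\<exists>a\<in>A. dist a x < 3)) \<and>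
      (\<forall>b\<in>Basis. \<forall>x. \<bar>partial b \<theta> x\<bar> \<le> K \<and> \<bar>partial b (partial b \<theta>) x\<bar> \<le> K)"
    proof (cases "A = {}")
      case True
      then show ?thesis
        using \<open>K \<ge> 0\<close> by (intro exI[of _ "\<lambda>x. 0"]) (auto simp: smooth_def Ck_const)
    next
      case False
      define h where "h = (\<lambda>y. max 0 (min 1 (2 - infdist y A)))"
      have h: "continuous_on UNIV h" "\<And>y. \<bar>h y\<bar> \<le> 1" "\<And>y. 0 \<le> h y"
        unfolding h_def by (auto intro!: continuous_intros)
      obtain e where e: "\<And>a. a \<in> A \<Longrightarrow> norm a \<le> e" using \<open>bounded A\<close> bounded_iff by blast
      obtain m where m: "cball (0::'b) (e + 1) \<subseteq> cbox (-m) m"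
        using bounded_subset_cbox_symmetric[OF bounded_cball] by blast
      define \<theta> where "\<theta> = mollify (-m) m h \<rho>"
      have d1: "partial b \<theta> = mollify (-m) m h (partial b \<rho>)" if "b \<in> Basis" for b
        unfolding \<theta>_def using partial_mollify[OF h(1) C1 that] by blast
      have d2: "partial b (partial b \<theta>) = mollify (-m) m h (partial b (partial b \<rho>))" if "b \<in> Basis" for b
        unfolding d1[OF that] using partial_mollify[OF h(1) C1'[OF that] that] by blast
      have int: "(\<lambda>y. h y * \<rho> (z - y)) integrable_on cbox (-m) m" for z
        by (intro integrable_continuous continuous_on_mult continuous_on_subset[OF h(1)]
            continuous_on_compose2[OF cont(1)[of UNIV]] continuous_intros) auto
      have "0 \<le> \<theta> z" for z
        unfolding \<theta>_def mollify_def by (intro integral_nonneg int) (simp add: h nn)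
      moreover have "\<theta> z \<le> 1" for z
      proof -
        have "\<bar>\<theta> z\<bar> \<le> N \<rho>" unfolding \<theta>_def N_def
          by (rule mollify_bound[OF cont(1) s0 h(1,2)])
        then show ?thesis using int1 nn by (simp add: N_def)
      qed
      moreover have "\<theta> z = 1" if "z \<in> A" for z
      proof -
        have "((\<lambda>y. \<rho> (z - y)) has_integral 1) UNIV"
          using has_integral_reflect_translate[OF cont(1) s0, of z] int1 by simp
        moreover have "\<rho> (z - y) = (if y \<in> cbox (-m) m then h y * \<rho> (z - y) else 0)" for y
        proof (cases "norm (z - y) < 1")
          case True
          have "infdist y A \<le> 1" using infdist_le2[OF that, of y 1] True by (simp add: dist_norm norm_minus_commute)
          moreover have "norm y \<le> e + 1"
            using e[OF that] True norm_triangle_ineq4[of z "z - y"] by simp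
          then have "y \<in> cbox (-m) m" using m by auto
          ultimately show ?thesis by (simp add: h_def)
        qed (simp add: supp)
        ultimately have "((\<lambda>y. if y \<in> cbox (-m) m then h y * \<rho> (z - y) else 0) has_integral 1) UNIV"
          by simp
        then have "((\<lambda>y. h y * \<rho> (z - y)) has_integral 1) (cbox (-m) m)"
          by (simp only: has_integral_restrict_UNIV)
        then show ?thesis unfolding \<theta>_def mollify_def by (rule integral_unique)
      qed
      moreover have "\<exists>a\<in>A. dist a z < 3" if "\<theta> z \<noteq> 0" for z
      proof (rule ccontr)
        assume no: "\<not> (\<exists>a\<in>A. dist a z < 3)"
        have "h y * \<rho> (z - y) = 0" for y
        proof (cases "norm (z - y) < 1")
          case True
          have "2 \<le> infdist y A"
          proof (rule le_infdist[OF False])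
            fix a assume "a \<in> A"
            then have "3 \<le> dist a z" using no by force
            then show "2 \<le> dist y a"
              using True dist_triangle[of a z y] by (simp add: dist_norm norm_minus_commute)
          qed
          then show ?thesis by (simp add: h_def)
        qed (simp add: supp)
        then have "\<theta> z = 0" unfolding \<theta>_def mollify_def by (simp only: integral_0)
        with that show False by simp
      qed
      moreover have "\<bar>partial b \<theta> z\<bar> \<le> K" if b: "b \<in> Basis" for b z
      proof -
        have "\<bar>partial b \<theta> z\<bar> \<le> N (partial b \<rho>)" unfolding fun_cong[OF d1[OF b], of z] N_def
          by (rule mollify_bound[OF cont(2)[OF b] s1 h(1,2)])
        then show ?thesis using NK(1)[OF b] by linarith
      qed
      moreover have "\<bar>partial b (partial b \<theta>) z\<bar> \<le> K" if b: "b \<in> Basis" for b z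
      proof -
        have "\<bar>partial b (partial b \<theta>) z\<bar> \<le> N (partial b (partial b \<rho>))" unfolding fun_cong[OF d2[OF b], of z] N_def
          by (rule mollify_bound[OF cont(3)[OF b] s2 h(1,2)])
        then show ?thesis using NK(2)[OF b] by linarith
      qed
      moreover have "smooth \<theta>" unfolding \<theta>_def by (rule smooth_mollify[OF h(1) sm])
      ultimately show ?thesis by blast
    qed
  qed
qed

lemma partial_mult:
  "smooth f \<Longrightarrow> smooth g \<Longrightarrow> partial b (\<lambda>x. f x * g x) x = f x * partial b g x + partial b f x * g x"
  by (rule partial_eqI) (intro has_derivative_mult smooth_derivative)

lemma partial_cmult: "smooth f \<Longrightarrow> partial b (\<lambda>x. c * f x) x = c * partial b f x"
  by (rule partial_eqI) (intro has_derivative_mult_right smooth_derivative)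

lemma smooth_cmult: "smooth f \<Longrightarrow> smooth (\<lambda>x. c * f x)"
  unfolding smooth_def by (intro allI Ck_mult Ck_const) blast

lemma smooth_power: "smooth f \<Longrightarrow> smooth (\<lambda>x. f x ^ n)"
  by (simp add: smooth_def Ck_power)

lemma smooth_compose_linear: "smooth f \<Longrightarrow> bounded_linear A \<Longrightarrow> smooth (\<lambda>x. f (A x))"
  by (simp add: smooth_def Ck_compose_linear)

lemma partial_power:
  "smooth f \<Longrightarrow> partial b (\<lambda>x. f x ^ n) x = of_nat n * f x ^ (n - 1) * partial b f x"
proof (rule partial_eqI)
  assume "smooth f"
  from has_derivative_power[OF smooth_derivative[OF this]]
  show "((\<lambda>x. f x ^ n) has_derivative (\<lambda>v. of_nat n * f x ^ (n - 1) * frechet_derivative f (at x) v)) (at x)"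
    by (simp add: mult_ac)
qed

lemma partial_scale:
  assumes "smooth f"
  shows "partial b (\<lambda>x. f (c *\<^sub>R x)) x = c * partial b f (c *\<^sub>R x)"
proof (rule partial_eqI)
  note d = smooth_derivative[OF assms]
  have "((\<lambda>x. f (c *\<^sub>R x)) has_derivative (\<lambda>v. frechet_derivative f (at (c *\<^sub>R x)) (c *\<^sub>R v))) (at x)"
    by (rule has_derivative_compose[OF _ d]) (auto intro!: derivative_eq_intros)
  moreover have "frechet_derivative f (at y) (c *\<^sub>R v) = c * frechet_derivative f (at y) v" for y v
    using linear_cmul[OF bounded_linear.linear[OF has_derivative_bounded_linear[OF d]]] by simp
  ultimately show "((\<lambda>x. f (c *\<^sub>R x)) has_derivative (\<lambda>v. c * frechet_derivative f (at (c *\<^sub>R x)) v)) (at x)"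
    by simp
qed

text \<open>Two modifications of the unit cutoff. Rescaling by \<open>3 / r\<close> produces the factors
  \<open>1 / r\<close> and \<open>1 / r\<^sup>2\<close>. Raising to a large power \<open>s\<close> makes the derivatives small where the cutoff
  is small: two derivatives of \<open>\<theta> ^ s\<close> leave a factor \<open>\<theta> ^ (s - 2)\<close>, and this is at most
  \<open>(\<theta> ^ s) powr \<alpha>\<close> as soon as \<open>s * \<alpha> \<le> s - 2\<close>. With \<open>\<alpha> = 1 / q\<close> these weights are exactly what
  Young's inequality needs to absorb the error terms into the energy.\<close>

lemma exists_cutoff:
  assumes \<alpha>: "0 \<le> \<alpha>" "\<alpha> < 1"
  shows "\<exists>K\<ge>0. \<forall>(A::'b::euclidean_space set) r. bounded A \<longrightarrow> r > 0 \<longrightarrow>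
    (\<exists>g. smooth g \<and> (\<forall>x. 0 \<le> g x \<and> g x \<le> 1) \<and> (\<forall>x\<in>A. g x = 1) \<and>
      (\<forall>x. g x \<noteq> 0 \<longrightarrow> (\<exists>a\<in>A. dist a x < r)) \<and>
      (\<forall>b\<in>Basis. \<forall>x. \<bar>partial b g x\<bar> \<le> K / r * g x powr \<alpha> \<and>
         \<bar>partial b (partial b g) x\<bar> \<le> K / r\<^sup>2 * g x powr \<alpha>))"
proof -
  obtain K where K: "K \<ge> 0" and ex: "\<And>A::'b set. bounded A \<Longrightarrow>
    (\<exists>\<theta>. smooth \<theta> \<and> (\<forall>x. 0 \<le> \<theta> x \<and> \<theta> x \<le> 1) \<and> (\<forall>x\<in>A. \<theta> x = 1) \<and>
      (\<forall>x. \<theta> x \<noteq> 0 \<longrightarrow> (\<exists>a\<in>A. dist a x < 3)) \<and>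
      (\<forall>b\<in>Basis. \<forall>x. \<bar>partial b \<theta> x\<bar> \<le> K \<and> \<bar>partial b (partial b \<theta>) x\<bar> \<le> K))"
    using exists_unit_cutoff[where 'b='b] by blast
  obtain s where s: "real s > max 2 (2 / (1 - \<alpha>))" using reals_Archimedean2 by blast
  then have s2: "s > 2" by linarith
  have "2 < real s * (1 - \<alpha>)" using s \<alpha> by (simp add: field_simps)
  then have sa: "real s * \<alpha> \<le> real (s - 2)" using s2 by (simp add: of_nat_diff algebra_simps)
  have pw: "t ^ (s - 2) \<le> (t ^ s) powr \<alpha>" if "0 \<le> t" "t \<le> 1" for t :: real
  proof (cases "t = 0")
    case False
    then have "t ^ (s - 2) = t powr real (s - 2)" using that by (simp add: powr_realpow)
    also have "\<dots> \<le> t powr (real s * \<alpha>)" using that False sa by (intro powr_mono') auto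
    also have "\<dots> = (t ^ s) powr \<alpha>" using that False by (simp add: powr_powr powr_realpow[symmetric])
    finally show ?thesis .
  next
    case True
    have "(0::real) ^ (s - 2) = 0" using s2 by (intro zero_power) simp
    with True show ?thesis by (metis powr_ge_zero)
  qed
  \<comment> \<open>The factor 9 is the square of the scaling factor 3 that turns the support radius 3 into r.\<close>
  define K' where "K' = 9 * (real s * K + real s * real s * K * K)"
  show ?thesis
  proof (intro exI[of _ K'] conjI allI impI)
    show "K' \<ge> 0" using K by (simp add: K'_def)
    fix A :: "'b set" and r :: real
    assume "bounded A" "r > 0"
    define c where "c = 3 / r"
    have c: "c > 0" using \<open>r > 0\<close> by (simp add: c_def)
    have "bounded ((\<lambda>x. c *\<^sub>R x) ` A)" using \<open>bounded A\<close> by (rule bounded_scaling)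
    from ex[OF this] obtain \<theta> where \<theta>: "smooth \<theta> \<and> (\<forall>x. 0 \<le> \<theta> x \<and> \<theta> x \<le> 1) \<and>
        (\<forall>x\<in>(\<lambda>x. c *\<^sub>R x) ` A. \<theta> x = 1) \<and>
        (\<forall>x. \<theta> x \<noteq> 0 \<longrightarrow> (\<exists>a\<in>(\<lambda>x. c *\<^sub>R x) ` A. dist a x < 3)) \<and>
        (\<forall>b\<in>Basis. \<forall>x. \<bar>partial b \<theta> x\<bar> \<le> K \<and> \<bar>partial b (partial b \<theta>) x\<bar> \<le> K)" ..
    note sm = \<theta>[THEN conjunct1] and \<theta>' = \<theta>[THEN conjunct2]
    have \<theta>01: "0 \<le> \<theta> x" "\<theta> x \<le> 1" for x using \<theta>'[THEN conjunct1] by simp_all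
    note \<theta>'' = \<theta>'[THEN conjunct2]
    note \<theta>1' = \<theta>''[THEN conjunct1] and \<theta>s' = \<theta>''[THEN conjunct2, THEN conjunct1]
    have \<theta>d: "\<bar>partial b \<theta> x\<bar> \<le> K" "\<bar>partial b (partial b \<theta>) x\<bar> \<le> K" if "b \<in> Basis" for b x
      using \<theta>''[THEN conjunct2, THEN conjunct2] that by simp_all
    have \<theta>1: "\<theta> (c *\<^sub>R x) = 1" if "x \<in> A" for x using \<theta>1' that by blast
    have \<theta>s: "\<exists>a\<in>A. dist (c *\<^sub>R a) x < 3" if "\<theta> x \<noteq> 0" for x using \<theta>s' that by blast
    define G where "G = (\<lambda>x. \<theta> x ^ s)"
    have smG: "smooth G" unfolding G_def by (rule smooth_power[OF sm])
    define g where "g = (\<lambda>x. G (c *\<^sub>R x))"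
    have smg: "smooth g" unfolding g_def
      by (rule smooth_compose_linear[OF smG]) (rule bounded_linear_scaleR_right)
    have d1: "partial b g x = c * partial b G (c *\<^sub>R x)" for b x
      unfolding g_def by (rule partial_scale[OF smG])
    have d2: "partial b (partial b g) x = c * c * partial b (partial b G) (c *\<^sub>R x)" if b: "b \<in> Basis" for b x
    proof -
      have smp: "smooth (partial b G)" by (rule smooth_partial[OF smG b])
      have "partial b (partial b g) x = partial b (\<lambda>x. c * partial b G (c *\<^sub>R x)) x"
        unfolding d1 ..
      also have "\<dots> = c * partial b (\<lambda>x. partial b G (c *\<^sub>R x)) x"
        by (rule partial_cmult[OF smooth_compose_linear[OF smp]]) (rule bounded_linear_scaleR_right)
      also have "\<dots> = c * (c * partial b (partial b G) (c *\<^sub>R x))"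
        by (simp only: partial_scale[OF smp])
      finally show ?thesis by simp
    qed
    have D1x: "partial b G x = (real s * \<theta> x ^ (s - 1)) * partial b \<theta> x" for b x
      unfolding G_def by (rule partial_power[OF sm])
    then have D1: "partial b G = (\<lambda>x. (real s * \<theta> x ^ (s - 1)) * partial b \<theta> x)" for b
      by (rule ext)
    have D2: "partial b (partial b G) x = real s * \<theta> x ^ (s - 1) * partial b (partial b \<theta>) x
        + real s * real (s - 1) * \<theta> x ^ (s - 2) * (partial b \<theta> x * partial b \<theta> x)" if b: "b \<in> Basis" for b x
    proof -
      have "partial b (partial b G) x = (real s * \<theta> x ^ (s - 1)) * partial b (partial b \<theta>) x
          + partial b (\<lambda>x. real s * \<theta> x ^ (s - 1)) x * partial b \<theta> x"
        unfolding D1 by (rule partial_mult[OF smooth_cmult[OF smooth_power[OF sm]] smooth_partial[OF sm b]])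
      also have "partial b (\<lambda>x. real s * \<theta> x ^ (s - 1)) x = real s * (real (s - 1) * \<theta> x ^ (s - 2) * partial b \<theta> x)"
        using partial_cmult[OF smooth_power[OF sm]] partial_power[OF sm, where n="s - 1"] by (simp add: numeral_2_eq_2)
      finally show ?thesis by (simp add: mult_ac)
    qed
    have pl: "\<theta> x ^ (s - 1) \<le> \<theta> x ^ (s - 2)" for x
      by (rule power_decreasing) (use \<theta>01 in auto)
    have GP: "\<theta> x ^ (s - 2) \<le> G x powr \<alpha>" for x unfolding G_def by (rule pw) (use \<theta>01 in auto)
    have B1: "\<bar>partial b G x\<bar> \<le> real s * K * G x powr \<alpha>" if b: "b \<in> Basis" for b x
    proof -
      have "\<bar>partial b G x\<bar> = real s * \<theta> x ^ (s - 1) * \<bar>partial b \<theta> x\<bar>"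
        using D1x[of x b] \<theta>01(1)[of x] by (simp add: abs_mult)
      also have "\<dots> \<le> real s * G x powr \<alpha> * K"
        using \<theta>d(1)[OF b, of x] order_trans[OF pl GP, of x] \<theta>01(1)[of x] K by (intro mult_mono) auto
      finally show ?thesis by (simp add: mult_ac)
    qed
    have B2: "\<bar>partial b (partial b G) x\<bar> \<le> (real s * K + real s * real s * K * K) * G x powr \<alpha>" if b: "b \<in> Basis" for b x
    proof -
      have "\<bar>partial b (partial b G) x\<bar> \<le> \<bar>real s * \<theta> x ^ (s - 1) * partial b (partial b \<theta>) x\<bar>
        + \<bar>real s * real (s - 1) * \<theta> x ^ (s - 2) * (partial b \<theta> x * partial b \<theta> x)\<bar>"
        unfolding D2[OF b] by (rule abs_triangle_ineq)
      also have "\<dots> = real s * \<theta> x ^ (s - 1) * \<bar>partial b (partial b \<theta>) x\<bar>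
        + real s * real (s - 1) * \<theta> x ^ (s - 2) * (\<bar>partial b \<theta> x\<bar> * \<bar>partial b \<theta> x\<bar>)"
        using \<theta>01(1)[of x] by (simp add: abs_mult)
      also have "\<dots> \<le> real s * G x powr \<alpha> * K + real s * real s * G x powr \<alpha> * (K * K)"
        using \<theta>d[OF b, of x] order_trans[OF pl GP, of x] GP[of x] \<theta>01(1)[of x] K
        by (intro add_mono mult_mono mult_nonneg_nonneg) auto
      finally show ?thesis by (simp add: algebra_simps)
    qed
    show "\<exists>g. smooth g \<and> (\<forall>x. 0 \<le> g x \<and> g x \<le> 1) \<and> (\<forall>x\<in>A. g x = 1) \<and>
      (\<forall>x. g x \<noteq> 0 \<longrightarrow> (\<exists>a\<in>A. dist a x < r)) \<and>
      (\<forall>b\<in>Basis. \<forall>x. \<bar>partial b g x\<bar> \<le> K' / r * g x powr \<alpha> \<and>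
         \<bar>partial b (partial b g) x\<bar> \<le> K' / r\<^sup>2 * g x powr \<alpha>)"
    proof (intro exI[of _ g] conjI allI ballI impI)
      show "smooth g" by (rule smg)
      show "0 \<le> g x" "g x \<le> 1" for x using \<theta>01 by (auto simp: g_def G_def power_le_one)
      show "g x = 1" if "x \<in> A" for x using \<theta>1[OF that] by (simp add: g_def G_def)
      show "\<exists>a\<in>A. dist a x < r" if "g x \<noteq> 0" for x
      proof -
        have "\<theta> (c *\<^sub>R x) \<noteq> 0" using that s2 by (auto simp: g_def G_def)
        then obtain a where a: "a \<in> A" "dist (c *\<^sub>R a) (c *\<^sub>R x) < 3" using \<theta>s by blast
        then have "c * dist a x < 3" using c by (simp add: dist_norm scaleR_diff_right[symmetric])
        then have "dist a x < r" using \<open>r > 0\<close> by (simp add: c_def field_simps)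
        with a show ?thesis by blast
      qed
      fix b :: 'b and x assume b: "b \<in> Basis"
      have "\<bar>partial b g x\<bar> \<le> c * (real s * K * g x powr \<alpha>)"
        using B1[OF b, of "c *\<^sub>R x"] c unfolding d1 by (simp add: abs_mult g_def)
      also have "\<dots> \<le> c * ((K' / 3) * g x powr \<alpha>)"
        using c K by (intro mult_left_mono mult_right_mono) (auto simp: K'_def)
      finally show "\<bar>partial b g x\<bar> \<le> K' / r * g x powr \<alpha>" by (simp add: c_def)
      have K9: "K' / 9 = real s * K + real s * real s * K * K" by (simp add: K'_def)
      have "\<bar>partial b (partial b g) x\<bar> \<le> c * c * ((K' / 9) * g x powr \<alpha>)"
        using B2[OF b, of "c *\<^sub>R x"] c unfolding d2[OF b] K9 by (simp add: abs_mult g_def)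
      also have "\<dots> = K' / r\<^sup>2 * g x powr \<alpha>" by (simp add: c_def power2_eq_square)
      finally show "\<bar>partial b (partial b g) x\<bar> \<le> K' / r\<^sup>2 * g x powr \<alpha>" .
    qed
  qed
qed

section \<open>Moving the Laplacian onto a product test function\<close>

lemma smooth_product:
  fixes p :: "'a::euclidean_space \<Rightarrow> real" and q :: "real \<Rightarrow> real"
  assumes "smooth p" "smooth q"
  shows "smooth (\<lambda>z. p (fst z) * q (snd z))"
  by (intro smooth_mult smooth_compose_linear[OF assms(1) bounded_linear_fst]
      smooth_compose_linear[OF assms(2) bounded_linear_snd])

lemma partial_product:
  fixes p :: "'a::euclidean_space \<Rightarrow> real" and q :: "real \<Rightarrow> real"
  assumes "smooth p" "smooth q"
  shows "partial (v, r) (\<lambda>z. p (fst z) * q (snd z)) z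
    = partial v p (fst z) * q (snd z) + p (fst z) * partial r q (snd z)"
proof -
  have 1: "((\<lambda>z. p (fst z)) has_derivative (\<lambda>v. partial (fst v) p (fst z))) (at z)"
    by (rule has_derivative_compose[OF _ smooth_derivative[OF assms(1)]]) (auto intro!: derivative_eq_intros)
  have 2: "((\<lambda>z. q (snd z)) has_derivative (\<lambda>v. partial (snd v) q (snd z))) (at z)"
    by (rule has_derivative_compose[OF _ smooth_derivative[OF assms(2)]]) (auto intro!: derivative_eq_intros)
  show ?thesis
    using partial_eqI[OF has_derivative_mult[OF 1 2], of "(v, r)"] by simp
qed

lemma partial_zero: "smooth f \<Longrightarrow> partial 0 f x = 0"
  using linear_0[OF bounded_linear.linear[OF has_derivative_bounded_linear[OF smooth_derivative]]] .

lemma smooth_derivative_sum: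
  assumes "smooth f" shows "partial v f x = (\<Sum>b\<in>Basis. (v \<bullet> b) * partial b f x)"
  using has_derivative_bounded_linear[OF smooth_derivative[OF assms, of x]]
  by (subst euclidean_representation[of v, symmetric])
     (simp add: linear_sum linear_cmul bounded_linear.linear)

lemma grad_x_product:
  fixes g :: "'a::euclidean_space \<Rightarrow> real"
  assumes "smooth g"
  shows "grad_x (\<lambda>z. g (fst z) * h (snd z)) z = (\<Sum>b\<in>Basis. (partial b g (fst z) * h (snd z)) *\<^sub>R b)"
proof -
  have "((\<lambda>y. g y * h (snd z)) has_derivative (\<lambda>v. partial v g (fst z) * h (snd z))) (at (fst z))"
    by (intro has_derivative_mult_left smooth_derivative assms)
  moreover have "(\<lambda>v. partial v g (fst z) * h (snd z))
      = (\<lambda>v. v \<bullet> (\<Sum>b\<in>Basis. (partial b g (fst z) * h (snd z)) *\<^sub>R b))"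
    by (rule ext, subst smooth_derivative_sum[OF assms])
       (simp add: inner_sum_right sum_distrib_left mult_ac)
  ultimately have G: "GDERIV (\<lambda>y. g y * h (snd z)) (fst z) :> (\<Sum>b\<in>Basis. (partial b g (fst z) * h (snd z)) *\<^sub>R b)"
    unfolding gderiv_def by (rule has_derivative_eq_rhs)
  show ?thesis
    unfolding grad_x_def fst_conv snd_conv
  proof (rule the_equality, rule G)
    fix D assume "GDERIV (\<lambda>y. g y * h (snd z)) (fst z) :> D"
    then have "(\<lambda>v. v \<bullet> D) = (\<lambda>v. v \<bullet> (\<Sum>b\<in>Basis. (partial b g (fst z) * h (snd z)) *\<^sub>R b))"
      using G
      unfolding gderiv_def by (rule has_derivative_unique)
    then show "D = (\<Sum>b\<in>Basis. (partial b g (fst z) * h (snd z)) *\<^sub>R b)"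
      by (metis vector_eq_ldot)
  qed
qed

lemma deriv_t_product:
  assumes "smooth h"
  shows "deriv_t (\<lambda>z. g (fst z) * h (snd z)) z = g (fst z) * partial 1 h (snd z)"
proof -
  have "(h has_derivative (\<lambda>v. v * partial 1 h (snd z))) (at (snd z))"
  proof -
    have "frechet_derivative h (at (snd z)) = (\<lambda>v. v * partial 1 h (snd z))"
      by (rule ext) (subst smooth_derivative_sum[OF assms], simp)
    then show ?thesis using smooth_derivative[OF assms, of "snd z"] by simp
  qed
  then have "(h has_real_derivative partial 1 h (snd z)) (at (snd z))"
    by (simp add: has_field_derivative_def mult_commute_abs)
  then have "((\<lambda>s. g (fst z) * h s) has_real_derivative g (fst z) * partial 1 h (snd z)) (at (snd z))"
    by (rule DERIV_cmult)
  then show ?thesis by (simp add: deriv_t_def DERIV_imp_deriv)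
qed

text \<open>Bounded partial derivatives bound the operator norm of the derivative, and the whole
  space is convex.\<close>

lemma smooth_lipschitz:
  fixes f :: "'b::euclidean_space \<Rightarrow> real"
  assumes sm: "smooth f" and B: "\<And>b x. b \<in> Basis \<Longrightarrow> \<bar>partial b f x\<bar> \<le> B"
  shows "\<exists>L. L-lipschitz_on S f"
proof -
  define M where "M = real DIM('b) * \<bar>B\<bar>"
  have "\<bar>partial v f x\<bar> \<le> M * norm v" for v x
  proof -
    have "\<bar>partial v f x\<bar> \<le> (\<Sum>b\<in>Basis. \<bar>(v \<bullet> b) * partial b f x\<bar>)"
      by (subst smooth_derivative_sum[OF sm]) (rule sum_abs)
    also have "\<dots> \<le> (\<Sum>b\<in>(Basis::'b set). norm v * \<bar>B\<bar>)"
      by (intro sum_mono) (auto simp: abs_mult Basis_le_norm intro!: mult_mono order_trans[OF B abs_ge_self])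
    finally show ?thesis by (simp add: M_def mult_ac)
  qed
  then have on: "onorm (frechet_derivative f (at x)) \<le> M" for x
    by (intro onorm_le) simp
  have "norm (f x - f y) \<le> M * norm (x - y)" for x y
    by (rule differentiable_bound[of UNIV f "\<lambda>x. frechet_derivative f (at x)" M])
       (use smooth_derivative[OF sm] on in auto)
  then have "M-lipschitz_on S f"
    by (intro lipschitz_onI) (auto simp: dist_norm M_def)
  then show ?thesis ..
qed

text \<open>On a compact set square integrability implies integrability, since
  \<open>s \<le> 1 + s\<^sup>2\<close>.\<close>

lemma Lp_loc_2_absolutely_integrable:
  fixes f :: "'b::euclidean_space \<Rightarrow> 'c::euclidean_space"
  assumes f: "f \<in> Lp_loc 2 S (\<lambda>_. 1)" and K: "compact K" "K \<subseteq> S"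
  shows "f absolutely_integrable_on K"
proof (rule measurable_bounded_by_integrable_imp_absolutely_integrable)
  have 1: "f \<in> borel_measurable (lebesgue_on K)" "(\<lambda>x. norm (f x) powr 2 * 1) absolutely_integrable_on K"
    using f K unfolding Lp_loc_def by blast+
  show "f \<in> borel_measurable (lebesgue_on K)" by (rule 1)
  show "K \<in> sets lebesgue" using K by (simp add: borel_compact lmeasurable_compact fmeasurableD)
  show "(\<lambda>x. 1 + norm (f x) powr 2) integrable_on K"
    using 1(2) K by (intro integrable_add integrable_on_const lmeasurable_compact)
      (auto simp: absolutely_integrable_on_def)
  show "norm (f x) \<le> 1 + norm (f x) powr 2" for x
  proof -
    have "2 * norm (f x) \<le> 1 + (norm (f x))\<^sup>2"
      using zero_le_power2[of "norm (f x) - 1"] by (simp add: power2_diff)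
    then have "norm (f x) \<le> 1 + (norm (f x))\<^sup>2" using norm_ge_zero[of "f x"] by linarith
    then show ?thesis by simp
  qed
qed

lemma set_integrable_compact_support:
  fixes f m :: "'b::euclidean_space \<Rightarrow> real"
  assumes f: "f absolutely_integrable_on Q" and Q: "compact Q" and D: "D \<in> sets lebesgue"
    and m: "continuous_on UNIV m" and s: "\<And>z. z \<in> D - Q \<Longrightarrow> m z = 0"
  shows "set_integrable lebesgue D (\<lambda>z. f z * m z)"
proof -
  have Qs: "Q \<in> sets lebesgue" using Q by (simp add: borel_compact lmeasurable_compact fmeasurableD)
  have mQ: "continuous_on Q m" using m continuous_on_subset by blast
  have "(\<lambda>z. m z * f z) absolutely_integrable_on Q"
    by (rule absolutely_integrable_bounded_measurable_product[OF bilinear_times _ Qs _ f])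
      (use mQ Q Qs in \<open>auto intro!: continuous_imp_measurable_on_sets_lebesgue compact_imp_bounded compact_continuous_image\<close>)
  then have "set_integrable lebesgue (D \<inter> Q) (\<lambda>z. m z * f z)"
    by (rule set_integrable_subset) (use D Qs in auto)
  moreover have "(\<lambda>z. indicator (D \<inter> Q) z *\<^sub>R (m z * f z)) = (\<lambda>z. indicator D z *\<^sub>R (f z * m z))"
  proof
    show "indicator (D \<inter> Q) z *\<^sub>R (m z * f z) = indicator D z *\<^sub>R (f z * m z)" for z
      using s[of z] by (auto simp: indicator_def)
  qed
  ultimately show ?thesis unfolding set_integrable_def by (simp only:)
qed

lemma open_cylinder_lebesgue: "open \<Omega> \<Longrightarrow> \<Omega> \<times> {0::real<..} \<in> sets lebesgue"
  by (intro sets_completionI_sets) (simp add: borel_open open_Times)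

text \<open>The factor \<open>exp (- 1 / (m t - 1))\<close>, extended by 0 to \<open>t \<le> 1 / m\<close>, is smooth in
  \<open>t\<close>, lies between 0 and 1, and tends to 1 for every \<open>t > 0\<close>. It switches off a neighbourhood of the
  initial time at no cost in the limit.\<close>

lemma time_cutoff_limit:
  fixes F :: "'a::euclidean_space \<times> real \<Rightarrow> real"
  assumes D: "D \<subseteq> UNIV \<times> {0<..}" and F: "set_integrable lebesgue D F"
  shows "(\<lambda>m. LINT z:D|lebesgue. F z * flat 0 (real m * snd z - 1)) \<longlonglongrightarrow> (LINT z:D|lebesgue. F z)"
  unfolding set_lebesgue_integral_def
proof (rule integral_dominated_convergence[where w="\<lambda>z. norm (indicator D z *\<^sub>R F z)"])
  have I: "integrable lebesgue (\<lambda>z. indicator D z *\<^sub>R F z)" using F by (simp add: set_integrable_def)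
  then show "(\<lambda>z. indicator D z *\<^sub>R F z) \<in> borel_measurable lebesgue"
    "integrable lebesgue (\<lambda>z. norm (indicator D z *\<^sub>R F z))" by auto
  have fl: "continuous_on UNIV (flat 0)" by (rule Ck_continuous[OF Ck_flat])
  have "continuous_on UNIV (\<lambda>z::'a\<times>real. flat 0 (real m * snd z - 1))" for m
    by (rule continuous_on_compose2[OF fl]) (auto intro!: continuous_intros)
  then have fm: "(\<lambda>z::'a\<times>real. flat 0 (real m * snd z - 1)) \<in> borel_measurable lebesgue" for m
    by (intro measurable_completion) (simp add: borel_measurable_continuous_onI)
  have "(\<lambda>z. (indicator D z *\<^sub>R F z) * flat 0 (real m * snd z - 1)) \<in> borel_measurable lebesgue" for m
    using fm I by (intro borel_measurable_times) auto
  then show "(\<lambda>z. indicator D z *\<^sub>R (F z * flat 0 (real m * snd z - 1))) \<in> borel_measurable lebesgue" for m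
    by (simp add: mult.assoc)
  have f1: "0 \<le> flat 0 t" "flat 0 t \<le> 1" for t by (auto simp: flat_def)
  show "AE z in lebesgue. norm (indicator D z *\<^sub>R (F z * flat 0 (real m * snd z - 1))) \<le> norm (indicator D z *\<^sub>R F z)" for m
    using f1 by (intro always_eventually allI) (auto simp: abs_mult mult_left_le indicator_def)
  have lim: "(\<lambda>m. flat 0 (real m * t - 1)) \<longlonglongrightarrow> 1" if t: "t > 0" for t :: real
  proof -
    have top: "filterlim (\<lambda>m. real m * t - 1) at_top sequentially"
      using t by real_asymp
    have "(\<lambda>m. exp (- (1 / (real m * t - 1)))) \<longlonglongrightarrow> 1"
      using t by real_asymp
    moreover have "\<forall>\<^sub>F m in sequentially. exp (- (1 / (real m * t - 1))) = flat 0 (real m * t - 1)"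
      using filterlim_at_top_dense[THEN iffD1, OF top, rule_format, of 0]
      by eventually_elim (simp add: flat_def)
    ultimately show ?thesis by (rule Lim_transform_eventually)
  qed
  show "AE z in lebesgue. (\<lambda>m. indicator D z *\<^sub>R (F z * flat 0 (real m * snd z - 1))) \<longlonglongrightarrow> indicator D z *\<^sub>R F z"
  proof (intro always_eventually allI)
    fix z
    show "(\<lambda>m. indicator D z *\<^sub>R (F z * flat 0 (real m * snd z - 1))) \<longlonglongrightarrow> indicator D z *\<^sub>R F z"
    proof (cases "z \<in> D")
      case True
      then have "snd z > 0" using D by auto
      from tendsto_mult[OF tendsto_const lim[OF this], of "F z"] show ?thesis using True by simp
    qed simp
  qed
qed

lemma set_integral_sum:
  fixes f :: "'i \<Rightarrow> 'a \<Rightarrow> 'b::{banach, second_countable_topology}"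
  assumes "\<And>i. i \<in> I \<Longrightarrow> set_integrable M A (f i)"
  shows "(LINT x:A|M. \<Sum>i\<in>I. f i x) = (\<Sum>i\<in>I. LINT x:A|M. f i x)"
  using assms unfolding set_lebesgue_integral_def set_integrable_def scaleR_sum_right
  by (rule Bochner_Integration.integral_sum)

text \<open>Weak derivatives are tested with functions supported in the open set
  \<open>\<Omega> \<times> (0, \<infinity>)\<close>, whereas \<open>g(x) h(t)\<close> may be nonzero up to \<open>t = 0\<close>. Multiplying by the time cutoff above
  yields admissible test functions; the cutoff commutes with derivatives in \<open>x\<close>, so nothing blows up
  when it is removed by dominated convergence. Here integrability up to \<open>t = 0\<close> of \<open>u\<close> and of its
  gradient enters.\<close>

lemma weak_laplacian:
  fixes u :: "'a::euclidean_space \<times> real \<Rightarrow> real"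
  assumes \<Omega>: "open \<Omega>" and u: "u \<in> W12_loc (\<Omega> \<times> {0..})"
    and g: "smooth g" "compact K" "K \<subseteq> \<Omega>" "\<And>x. x \<notin> K \<Longrightarrow> g x = 0"
    and h: "smooth h" "\<And>t. T \<le> t \<Longrightarrow> h t = 0"
  shows "(LINT z:\<Omega> \<times> {0<..}|lebesgue. fst (weak_grad (\<Omega> \<times> {0..}) u z) \<bullet>
            grad_x (\<lambda>z. g (fst z) * h (snd z)) z)
       = - (LINT z:\<Omega> \<times> {0<..}|lebesgue. u z * ((\<Sum>b\<in>Basis. partial b (partial b g) (fst z)) * h (snd z)))"
proof -
  define D where "D = \<Omega> \<times> {0::real<..}"
  define w where "w = weak_grad (\<Omega> \<times> {0..}) u"
  have int: "interior (\<Omega> \<times> {0..}) = D"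
    using \<Omega> by (simp add: D_def interior_Times interior_open interior_real_atLeast)
  have "\<exists>G. G \<in> Lp_loc 2 (\<Omega> \<times> {0..}) (\<lambda>_. 1) \<and> has_weak_gradient (interior (\<Omega> \<times> {0..})) u G"
    using u by (auto simp: W12_loc_def)
  from someI_ex[OF this] have w: "w \<in> Lp_loc 2 (\<Omega> \<times> {0..}) (\<lambda>_. 1)" "has_weak_gradient D u w"
    unfolding w_def weak_grad_def int by blast+
  have u2: "u \<in> Lp_loc 2 (\<Omega> \<times> {0..}) (\<lambda>_. 1)" using u by (simp add: W12_loc_def)
  have Ds: "D \<in> sets lebesgue" unfolding D_def by (rule open_cylinder_lebesgue[OF \<Omega>])
  define Q where "Q = K \<times> {0..T}"
  have Q: "compact Q" "Q \<subseteq> \<Omega> \<times> {0..}" using g by (auto simp: Q_def compact_Times)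
  have iu: "u absolutely_integrable_on Q" by (rule Lp_loc_2_absolutely_integrable[OF u2 Q])
  have iw0: "w absolutely_integrable_on Q" by (rule Lp_loc_2_absolutely_integrable[OF w(1) Q])
  have iw: "(\<lambda>z. w z \<bullet> (b, 0)) absolutely_integrable_on Q" for b
    using absolutely_integrable_component[OF iw0] by simp
  have op: "open (- K)" using g(2) compact_imp_closed by blast
  have g1: "partial b g x = 0" if "x \<notin> K" for b x
    by (rule partial_eq_0_on_open[OF op]) (use that g in auto)
  have g2: "partial b (partial b g) x = 0" if "x \<notin> K" for b x
    by (rule partial_eq_0_on_open[OF op]) (use that g1 in auto)
  have int1: "set_integrable lebesgue D (\<lambda>z. f z * (p (fst z) * h (snd z)))"
    if "f absolutely_integrable_on Q" "smooth p" "\<And>x. x \<notin> K \<Longrightarrow> p x = 0" for f p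
  proof (rule set_integrable_compact_support[OF that(1) Q(1) Ds smooth_continuous[OF smooth_product[OF that(2) h(1)]]])
    fix z assume "z \<in> D - Q"
    then have "fst z \<notin> K \<or> T \<le> snd z" by (cases z) (auto simp: D_def Q_def)
    then show "p (fst z) * h (snd z) = 0" using that(3) h(2) by auto
  qed
  have I1: "set_integrable lebesgue D (\<lambda>z. u z * (partial b (partial b g) (fst z) * h (snd z)))"
    if "b \<in> Basis" for b
    using iu smooth_partial[OF smooth_partial[OF g(1) that] that] g2 by (rule int1)
  have I2: "set_integrable lebesgue D (\<lambda>z. (w z \<bullet> (b, 0)) * (partial b g (fst z) * h (snd z)))"
    if "b \<in> Basis" for b
    using iw smooth_partial[OF g(1) that] g1 by (rule int1)
  have key: "(LINT z:D|lebesgue. u z * (partial b (partial b g) (fst z) * h (snd z)))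
      = - (LINT z:D|lebesgue. (w z \<bullet> (b, 0)) * (partial b g (fst z) * h (snd z)))" (is "?L = - ?R")
    if b: "b \<in> Basis" for b
  proof -
    have sp: "smooth (partial b g)" by (rule smooth_partial[OF g(1) b])
    define \<kappa> where "\<kappa> = (\<lambda>m t. flat 0 (real m * t - 1))"
    define \<psi> where "\<psi> = (\<lambda>m z. partial b g (fst z) * (h (snd z) * \<kappa> m (snd z)))"
    have "smooth (\<lambda>t. real m * t + (-1))" for m
      unfolding smooth_def by (intro allI Ck_add Ck_const Ck_linear bounded_linear_mult_right)
    then have "smooth (\<lambda>t. real m * t - 1)" for m by simp
    then have sc: "smooth (\<kappa> m)" for m unfolding \<kappa>_def by (rule smooth_flat_compose)
    have shc: "smooth (\<lambda>t. h t * \<kappa> m t)" for m by (rule smooth_mult[OF h(1) sc])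
    have s\<psi>: "smooth (\<psi> m)" for m unfolding \<psi>_def by (rule smooth_product[OF sp shc])
    have "\<psi> (Suc m) \<in> test_functions D" for m
    proof -
      have "compact (K \<times> {1 / real (Suc m)..T})" using g by (auto simp: compact_Times)
      moreover have "K \<times> {1 / real (Suc m)..T} \<subseteq> D"
      proof
        fix z assume z: "z \<in> K \<times> {1 / real (Suc m)..T}"
        have "0 < 1 / real (Suc m)" by simp
        also have "\<dots> \<le> snd z" using z unfolding mem_Times_iff atLeastAtMost_iff by blast
        finally have "0 < snd z" .
        moreover have "fst z \<in> \<Omega>" using z g(3) unfolding mem_Times_iff by blast
        ultimately show "z \<in> D" unfolding D_def mem_Times_iff greaterThan_iff by blast
      qed
      moreover have "\<psi> (Suc m) z = 0" if nz: "z \<notin> K \<times> {1 / real (Suc m)..T}" for z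
      proof -
        consider "fst z \<notin> K" | "T \<le> snd z" | "snd z < 1 / real (Suc m)"
          using nz unfolding mem_Times_iff atLeastAtMost_iff by linarith
        then show ?thesis
        proof cases
          case 3
          then have "real (Suc m) * snd z - 1 \<le> 0" by (simp add: field_simps)
          then show ?thesis by (simp add: \<psi>_def \<kappa>_def flat_def)
        next
          case 1
          then show ?thesis unfolding \<psi>_def using g1[OF 1] by simp
        next
          case 2
          then show ?thesis unfolding \<psi>_def using h(2)[OF 2] by simp
        qed
      qed
      ultimately show ?thesis using s\<psi>[of "Suc m"] unfolding test_functions_def smooth_def by blast
    qed
    moreover have "(b, 0) \<in> (Basis :: ('a \<times> real) set)" using b by (simp add: Basis_prod_def)
    ultimately have TI: "(LINT z:D|lebesgue. u z * partial (b, 0) (\<psi> (Suc m)) z)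
        = - (LINT z:D|lebesgue. (w z \<bullet> (b, 0)) * \<psi> (Suc m) z)" for m
      using w(2) unfolding has_weak_gradient_def by blast
    have PD: "partial (b, 0) (\<psi> m) z = partial b (partial b g) (fst z) * (h (snd z) * \<kappa> m (snd z))" for m z
      unfolding \<psi>_def partial_product[OF sp shc] partial_zero[OF shc] by simp
    \<comment> \<open>The defining identity of the weak derivative in direction (b, 0), tested with the time-cutoff product.\<close>
    have eq: "(LINT z:D|lebesgue. (u z * (partial b (partial b g) (fst z) * h (snd z))) * flat 0 (real (Suc m) * snd z - 1))
        = - (LINT z:D|lebesgue. ((w z \<bullet> (b, 0)) * (partial b g (fst z) * h (snd z))) * flat 0 (real (Suc m) * snd z - 1))" for m
      using TI[of m] unfolding PD by (simp only: \<psi>_def \<kappa>_def mult.assoc)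
    have Dt: "D \<subseteq> UNIV \<times> {0<..}" by (auto simp: D_def)
    have "(\<lambda>m. LINT z:D|lebesgue. (u z * (partial b (partial b g) (fst z) * h (snd z))) * flat 0 (real (Suc m) * snd z - 1)) \<longlonglongrightarrow> ?L"
      by (rule LIMSEQ_Suc[OF time_cutoff_limit[OF Dt I1[OF b]]])
    moreover have "(\<lambda>m. - (LINT z:D|lebesgue. ((w z \<bullet> (b, 0)) * (partial b g (fst z) * h (snd z))) * flat 0 (real (Suc m) * snd z - 1))) \<longlonglongrightarrow> - ?R"
      by (rule tendsto_minus[OF LIMSEQ_Suc[OF time_cutoff_limit[OF Dt I2[OF b]]]])
    ultimately show ?thesis unfolding eq by (rule LIMSEQ_unique)
  qed
  have "(LINT z:D|lebesgue. fst (w z) \<bullet> grad_x (\<lambda>z. g (fst z) * h (snd z)) z)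
      = (LINT z:D|lebesgue. \<Sum>b\<in>Basis. (w z \<bullet> (b, 0)) * (partial b g (fst z) * h (snd z)))"
    by (intro set_lebesgue_integral_cong Ds allI impI)
       (simp add: grad_x_product[OF g(1)] inner_sum_right inner_prod_def mult_ac)
  also have "\<dots> = (\<Sum>b\<in>Basis. LINT z:D|lebesgue. (w z \<bullet> (b, 0)) * (partial b g (fst z) * h (snd z)))"
    by (rule set_integral_sum[OF I2])
  also have "\<dots> = - (\<Sum>b\<in>Basis. LINT z:D|lebesgue. u z * (partial b (partial b g) (fst z) * h (snd z)))"
    unfolding sum_negf[symmetric] using key by (intro sum.cong) auto
  also have "(\<Sum>b\<in>Basis. LINT z:D|lebesgue. u z * (partial b (partial b g) (fst z) * h (snd z)))
      = (LINT z:D|lebesgue. \<Sum>b\<in>Basis. u z * (partial b (partial b g) (fst z) * h (snd z)))"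
    by (rule set_integral_sum[OF I1, symmetric])
  also have "(LINT z:D|lebesgue. \<Sum>b\<in>Basis. u z * (partial b (partial b g) (fst z) * h (snd z)))
      = (LINT z:D|lebesgue. u z * ((\<Sum>b\<in>Basis. partial b (partial b g) (fst z)) * h (snd z)))"
    unfolding sum_distrib_left sum_distrib_right ..
  finally show ?thesis
    unfolding D_def w_def .
qed

section \<open>Inequalities, inner domains and measurability\<close>

text \<open>Young's inequality with a free weight \<open>m\<close> and constants that are not optimal: either
  the second factor is dominated by \<open>m * a powr (q - 1)\<close>, or \<open>a\<close> is dominated by a power of \<open>w / m\<close>.\<close>

lemma powr_Young:
  fixes a w m q :: real
  assumes q: "q > 1" and a: "a \<ge> 0" and w: "w \<ge> 0" and m: "m > 0"
  shows "a * w \<le> m * a powr q + m powr (- 1 / (q - 1)) * w powr (q / (q - 1))"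
proof (cases "a = 0 \<or> w \<le> m * a powr (q - 1)")
  case True
  have "a * w \<le> m * a powr q"
  proof (cases "a = 0")
    case False
    then have "a * w \<le> a * (m * a powr (q - 1))" using True a by (intro mult_left_mono) auto
    also have "\<dots> = m * a powr q" using a False by (simp add: powr_diff)
    finally show ?thesis .
  qed simp
  then show ?thesis using m by (simp add: add_increasing2)
next
  case False
  then have a0: "a > 0" and w0: "w > m * a powr (q - 1)" using a by auto
  have wp: "w > 0" using w0 m a0 by (smt (verit) mult_nonneg_nonneg powr_ge_zero)
  have "a powr (q - 1) \<le> w / m" using w0 m by (simp add: field_simps)
  then have "(a powr (q - 1)) powr (1 / (q - 1)) \<le> (w / m) powr (1 / (q - 1))"
    using q by (intro powr_mono2) auto
  then have "a \<le> (w / m) powr (1 / (q - 1))" using q a0 by (simp add: powr_powr)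
  then have "a * w \<le> (w / m) powr (1 / (q - 1)) * w" using w by (rule mult_right_mono)
  also have "\<dots> = m powr (- 1 / (q - 1)) * (w powr (1 / (q - 1)) * w)"
    using wp m by (simp add: powr_divide powr_minus_divide)
  also have "w powr (1 / (q - 1)) * w = w powr (1 / (q - 1) + 1)"
    using wp by (simp add: powr_add)
  also have "1 / (q - 1) + 1 = q / (q - 1)" using q by (simp add: field_simps)
  finally show ?thesis using m a by (simp add: add_increasing)
qed

lemma inner_domain_antimono: "e \<le> e' \<Longrightarrow> inner_domain \<Omega> e' \<subseteq> inner_domain \<Omega> e"
  by (auto simp: inner_domain_def)

text \<open>Membership in \<open>\<Omega>\<close> may be replaced by membership in its closure, because the
  boundary points are at distance 0 from the boundary.\<close>

lemma compact_inner_domain: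
  fixes \<Omega> :: "'a::euclidean_space set"
  assumes "bounded \<Omega>" "e > 0"
  shows "compact (inner_domain \<Omega> e)"
proof -
  have "inner_domain \<Omega> e = closure \<Omega> \<inter> {x. e \<le> infdist x (frontier \<Omega>)}"
  proof -
    have "x \<in> \<Omega>" if "x \<in> closure \<Omega>" "e \<le> infdist x (frontier \<Omega>)" for x
    proof (rule ccontr)
      assume "x \<notin> \<Omega>"
      then have "x \<in> frontier \<Omega>" using that(1) interior_subset by (auto simp: frontier_def)
      then show False using that(2) assms(2) by simp
    qed
    then show ?thesis using closure_subset by (auto simp: inner_domain_def)
  qed
  moreover have "closed {x. e \<le> infdist x (frontier \<Omega>)}"
    by (intro closed_Collect_le continuous_intros)
  ultimately show ?thesis
    using assms(1) by (simp add: compact_Int_closed)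
qed

text \<open>The ball of radius \<open>e\<close> around a point at distance at least \<open>e\<close> from the boundary is
  connected and misses the boundary, hence stays in \<open>\<Omega>\<close>.\<close>

lemma inner_domain_thicken:
  fixes \<Omega> :: "'a::euclidean_space set"
  assumes a: "a \<in> inner_domain \<Omega> e" and d: "dist a x < \<delta>" "\<delta> \<le> e"
  shows "x \<in> inner_domain \<Omega> (e - \<delta>)"
proof -
  have e: "e \<le> infdist a (frontier \<Omega>)" "a \<in> \<Omega>" using a by (auto simp: inner_domain_def)
  have "x \<in> \<Omega>"
  proof (rule ccontr)
    assume x: "x \<notin> \<Omega>"
    have "ball a e \<inter> frontier \<Omega> \<noteq> {}"
    proof (rule connected_Int_frontier)
      have "a \<in> ball a e" using d zero_le_dist[of a x] by (auto simp del: zero_le_dist)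
      then show "ball a e \<inter> \<Omega> \<noteq> {}" using e by blast
      show "ball a e - \<Omega> \<noteq> {}" using x d by (auto simp: subset_eq intro!: exI[of _ x])
    qed simp
    then obtain p where "p \<in> frontier \<Omega>" "dist a p < e" by auto
    then show False using e infdist_le[of p "frontier \<Omega>" a] by simp
  qed
  moreover have "e - \<delta> \<le> infdist x (frontier \<Omega>)"
    using e infdist_triangle[of a "frontier \<Omega>" x] d by simp
  ultimately show ?thesis by (simp add: inner_domain_def)
qed

text \<open>A nonempty bounded set has a nonempty boundary, and an open set is disjoint from its boundary, which is closed.\<close>

lemma inner_domain_exhaust:
  fixes \<Omega> :: "'a::euclidean_space set"
  assumes "open \<Omega>" "bounded \<Omega>" "x \<in> \<Omega>"
  obtains e where "e > 0" "x \<in> inner_domain \<Omega> e"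
proof -
  have "\<Omega> \<noteq> UNIV" using assms(2) not_bounded_UNIV by auto
  then have "frontier \<Omega> \<noteq> {}" using assms(3) frontier_eq_empty by blast
  moreover have "x \<notin> frontier \<Omega>" using assms by (simp add: frontier_def interior_open)
  ultimately have "infdist x (frontier \<Omega>) > 0"
    using infdist_pos_not_in_closed[OF frontier_closed] by blast
  then show ?thesis using assms(3) by (intro that[of "infdist x (frontier \<Omega>)"]) (auto simp: inner_domain_def)
qed

text \<open>Local integrability only gives measurability on compact subsets; countably many of
  them, inner domains times bounded time intervals, exhaust the cylinder.\<close>

lemma measurable_on_open_cylinder:
  fixes \<Omega> :: "'a::euclidean_space set" and f :: "'a \<times> real \<Rightarrow> real"
  assumes \<Omega>: "open \<Omega>" "bounded \<Omega>"
    and f: "\<And>K. compact K \<Longrightarrow> K \<subseteq> \<Omega> \<times> {0..} \<Longrightarrow> f \<in> borel_measurable (lebesgue_on K)"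
  shows "(\<lambda>z. indicator (\<Omega> \<times> {0<..}) z * f z) \<in> borel_measurable lebesgue"
proof -
  define K where "K = (\<lambda>n. inner_domain \<Omega> (1 / real (Suc n)) \<times> {0..real n})"
  have cK: "compact (K n)" for n
    unfolding K_def using \<Omega>(2) by (intro compact_Times compact_inner_domain) auto
  have KS: "K n \<subseteq> \<Omega> \<times> {0..}" for n by (auto simp: K_def inner_domain_def)
  have Ks: "K n \<in> sets lebesgue" for n using cK by (simp add: fmeasurableD lmeasurable_compact)
  have mK: "(\<lambda>z. indicator (K n) z * f z) \<in> borel_measurable lebesgue" for n
    using f[OF cK KS] Ks by (simp add: borel_measurable_restrict_space_iff)
  have Ds: "\<Omega> \<times> {0<..} \<in> sets (lebesgue :: ('a \<times> real) measure)" by (rule open_cylinder_lebesgue[OF \<Omega>(1)])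
  show ?thesis
  proof (rule borel_measurable_LIMSEQ_real)
    show "(\<lambda>z. indicator (\<Omega> \<times> {0<..}) z * (indicator (K n) z * f z)) \<in> borel_measurable lebesgue" for n
      by (rule borel_measurable_times[OF borel_measurable_indicator[OF Ds] mK])
    fix z :: "'a \<times> real"
    show "(\<lambda>n. indicator (\<Omega> \<times> {0<..}) z * (indicator (K n) z * f z)) \<longlonglongrightarrow> indicator (\<Omega> \<times> {0<..}) z * f z"
    proof (cases "z \<in> \<Omega> \<times> {0<..}")
      case True
      then obtain e where e: "e > 0" "fst z \<in> inner_domain \<Omega> e"
        using inner_domain_exhaust[OF \<Omega>, of "fst z"] by (auto simp: mem_Times_iff)
      have "\<forall>\<^sub>F n in sequentially. 1 / real (Suc n) < e \<and> snd z < real n"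
      proof (rule eventually_conj)
        show "\<forall>\<^sub>F n in sequentially. 1 / real (Suc n) < e"
          using order_tendstoD(2)[OF LIMSEQ_inverse_real_of_nat e(1)] by (simp add: inverse_eq_divide)
        show "\<forall>\<^sub>F n in sequentially. snd z < real n"
          using filterlim_real_sequentially by (simp add: filterlim_at_top_dense)
      qed
      then have "\<forall>\<^sub>F n in sequentially. indicator (\<Omega> \<times> {0<..}) z * f z
          = indicator (\<Omega> \<times> {0<..}) z * (indicator (K n) z * f z)"
      proof eventually_elim
        case (elim n)
        then have "z \<in> K n" using True e(2) inner_domain_antimono[of "1 / real (Suc n)" e \<Omega>]
          unfolding K_def mem_Times_iff by auto
        then show ?case by simp
      qed
      then show ?thesis by (rule Lim_transform_eventually[OF tendsto_const])
    qed simp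
  qed
qed

lemma borel_product_lebesgue:
  fixes A :: "'a::euclidean_space set" and B :: "'b::euclidean_space set"
  assumes "A \<in> sets borel" "B \<in> sets borel" shows "A \<times> B \<in> sets lebesgue"
  using borel_Times[OF assms] by (intro sets_completionI_sets) simp

lemma product_in_lip_test_functions:
  fixes g :: "'a::euclidean_space \<Rightarrow> real" and h :: "real \<Rightarrow> real"
  assumes g: "smooth g" "\<And>x. 0 \<le> g x" "\<And>x. g x \<le> 1" "\<And>b x. b \<in> Basis \<Longrightarrow> \<bar>partial b g x\<bar> \<le> B"
    and h: "smooth h" "\<And>t. 0 \<le> h t" "\<And>t. h t \<le> 1" "\<And>t. \<bar>partial 1 h t\<bar> \<le> B'"
    and K: "compact K" "K \<subseteq> \<Omega>" "\<And>x. x \<notin> K \<Longrightarrow> g x = 0" and T: "\<And>t. T \<le> t \<Longrightarrow> h t = 0"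
  shows "(\<lambda>z. g (fst z) * h (snd z)) \<in> lip_test_functions (\<Omega> \<times> {0..})"
proof -
  have B0: "B' \<ge> 0" using h(4)[of 0] by linarith
  have "\<bar>partial c (\<lambda>z. g (fst z) * h (snd z)) z\<bar> \<le> \<bar>B\<bar> + B'" if "c \<in> Basis" for c z
  proof -
    have "(\<exists>b\<in>Basis. c = (b, 0)) \<or> c = (0, 1)" using that by (auto simp: Basis_prod_def)
    then show ?thesis
    proof
      assume "\<exists>b\<in>Basis. c = (b, 0)"
      then obtain b where b: "b \<in> Basis" "c = (b, 0)" by blast
      have "\<bar>partial c (\<lambda>z. g (fst z) * h (snd z)) z\<bar> = \<bar>partial b g (fst z)\<bar> * h (snd z)"
        unfolding b(2) partial_product[OF g(1) h(1)] partial_zero[OF h(1)] using h(2) by (simp add: abs_mult)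
      also have "\<dots> \<le> \<bar>B\<bar> * 1"
        using order_trans[OF g(4)[OF b(1)] abs_ge_self] h(2,3) by (intro mult_mono) auto
      finally show ?thesis using B0 by simp
    next
      assume c: "c = (0, 1)"
      have "\<bar>partial c (\<lambda>z. g (fst z) * h (snd z)) z\<bar> = g (fst z) * \<bar>partial 1 h (snd z)\<bar>"
        unfolding c partial_product[OF g(1) h(1)] partial_zero[OF g(1)] using g(2) by (simp add: abs_mult)
      also have "\<dots> \<le> 1 * B'" using g(2,3) h(4) by (intro mult_mono) auto
      finally show ?thesis by simp
    qed
  qed
  from smooth_lipschitz[OF smooth_product[OF g(1) h(1)] this, of "\<Omega> \<times> {0..}"]
  have "\<exists>L. L-lipschitz_on (\<Omega> \<times> {0..}) (\<lambda>z. g (fst z) * h (snd z))" .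
  moreover have "\<forall>z\<in>\<Omega> \<times> {0..}. 0 \<le> g (fst z) * h (snd z)" using g(2) h(2) by simp
  moreover have "compact (K \<times> {0..T})" "K \<times> {0..T} \<subseteq> \<Omega> \<times> {0..}" using K by (auto intro: compact_Times)
  moreover have "g (fst z) * h (snd z) = 0" if "z \<in> \<Omega> \<times> {0..} - K \<times> {0..T}" for z
  proof -
    have "fst z \<notin> K \<or> T \<le> snd z" using that by (cases z) auto
    then show ?thesis using K(3) T by auto
  qed
  ultimately show ?thesis unfolding lip_test_functions_def by blast
qed

section \<open>The energy estimate for one cutoff\<close>

text \<open>Off the cylinder both factors are replaced by 0, because nothing is known about them
  there.\<close>

lemma energy_measurable:
  fixes \<Omega> :: "'a::euclidean_space set" and V u :: "'a \<times> real \<Rightarrow> real"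
  assumes \<Omega>: "open \<Omega>" "bounded \<Omega>"
    and V: "V \<in> Lp_loc 1 (\<Omega> \<times> {0..}) (\<lambda>_. 1)" and u: "u \<in> Lp_loc 2 (\<Omega> \<times> {0..}) (\<lambda>_. 1)"
  shows "(\<lambda>z. indicator (\<Omega> \<times> {0<..}) z * (V z * u z powr q)) \<in> borel_measurable lebesgue"
proof -
  let ?i = "indicator (\<Omega> \<times> {0<..}) :: 'a \<times> real \<Rightarrow> real"
  have "(\<lambda>z. ?i z * V z) \<in> borel_measurable lebesgue"
    using V by (intro measurable_on_open_cylinder[OF \<Omega>]) (auto simp: Lp_loc_def)
  moreover have "(\<lambda>z. ?i z * u z) \<in> borel_measurable lebesgue"
    using u by (intro measurable_on_open_cylinder[OF \<Omega>]) (auto simp: Lp_loc_def)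
  ultimately have "(\<lambda>z. (?i z * V z) * (?i z * u z) powr q) \<in> borel_measurable lebesgue"
    by measurable
  moreover have "(\<lambda>z. (?i z * V z) * (?i z * u z) powr q) = (\<lambda>z. ?i z * (V z * u z powr q))"
    by (auto simp: indicator_def fun_eq_iff)
  ultimately show ?thesis by simp
qed

text \<open>Here \<open>w\<close> stands for the energy density \<open>V u\<^sup>q\<close> and \<open>\<kappa>\<close> for the negative exponent
  \<open>- 1 / (q - 1)\<close>. The energy localised by \<open>\<phi>\<close> is controlled, up to a term that is small for large
  \<open>\<mu>\<close>, by the part of it that lies outside the set where \<open>\<phi>\<close> is known to be 1. The constant \<open>M\<close> is a
  parameter since it must be the same for all \<open>e\<close> and \<open>T\<close>.\<close>

definition absorbing_cutoff ::
    "'a::euclidean_space set \<Rightarrow> real \<Rightarrow> real \<Rightarrow> ('a \<times> real \<Rightarrow> real) \<Rightarrow> real \<Rightarrow> real \<Rightarrow>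
     ('a \<times> real \<Rightarrow> real) \<Rightarrow> bool" where
  "absorbing_cutoff \<Omega> \<kappa> M w e T \<phi> \<longleftrightarrow>
     continuous_on UNIV \<phi> \<and> (\<forall>z. 0 \<le> \<phi> z \<and> \<phi> z \<le> 1) \<and>
     (\<forall>z \<in> inner_domain \<Omega> e \<times> {0<..T / 2}. \<phi> z = 1) \<and>
     (\<integral>\<^sup>+ z \<in> \<Omega> \<times> {0<..}. ennreal (w z * \<phi> z) \<partial>lebesgue) < \<infinity> \<and>
     (\<forall>\<mu>>0. (\<integral>\<^sup>+ z \<in> \<Omega> \<times> {0<..}. ennreal (w z * \<phi> z) \<partial>lebesgue)
       \<le> ennreal (2 * \<mu>) * (\<integral>\<^sup>+ z \<in> \<Omega> \<times> {0<..} - inner_domain \<Omega> e \<times> {0<..T / 2}.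
             ennreal (w z * \<phi> z) \<partial>lebesgue)
         + ennreal (M * \<mu> powr \<kappa>))"

text \<open>The test function is \<open>g(x) h(t)\<close>, with \<open>g\<close> cutting off near the boundary at scale
  \<open>\<epsilon>\<close> and \<open>h\<close> cutting off at time scale \<open>T\<close>. Integrating by parts once more in \<open>x\<close>, the weak
  formulation bounds the energy by the integral of \<open>u\<close> times \<open>|\<Delta>g| h + g |h'|\<close>, where the initial
  datum was dropped because of its sign. These factors are at most \<open>\<epsilon>\<^bsup>-2\<^esup>\<close> and \<open>T\<^bsup>-1\<^esup>\<close> times
  \<open>\<phi> powr (1 / q)\<close>, so Young's inequality splits each term into \<open>\<mu> V u\<^sup>q \<phi>\<close> and a multiple of
  \<open>V powr (- 1 / (q - 1))\<close>. The two integral hypotheses are scaled such that the second part is bounded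
  independently of \<open>\<epsilon>\<close> and \<open>T\<close>.\<close>

lemma test_function_estimate:
  fixes \<Omega> :: "'a::euclidean_space set" and V u :: "'a \<times> real \<Rightarrow> real"
  assumes \<Omega>: "open \<Omega>" "bounded \<Omega>" and q: "q > 1" and C: "C > 0"
    and V: "V \<in> Lp_loc 1 (\<Omega> \<times> {0..}) (\<lambda>_. 1)"
    and Vpos: "AE z in lebesgue. z \<in> \<Omega> \<times> {0<..} \<longrightarrow> V z > 0"
    and u0: "AE x in lebesgue. x \<in> \<Omega> \<longrightarrow> u0 x \<ge> 0"
    and sol: "weak_solution \<Omega> q V u0 u"
  shows "\<exists>M\<ge>0. \<forall>\<epsilon>>0. \<forall>T>0.
    (\<integral>\<^sup>+ z \<in> (inner_domain \<Omega> (\<epsilon> / 2) - inner_domain \<Omega> \<epsilon>) \<times> {0<..<T}.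
       ennreal (V z powr (- 1 / (q - 1))) \<partial>lebesgue) \<le> ennreal (C * \<epsilon> powr (2 * q / (q - 1))) \<longrightarrow>
    (\<integral>\<^sup>+ z \<in> inner_domain \<Omega> (\<epsilon> / 2) \<times> {T / 2<..<T}.
       ennreal (V z powr (- 1 / (q - 1))) \<partial>lebesgue) \<le> ennreal (C * T powr (q / (q - 1))) \<longrightarrow>
    (\<exists>\<phi>. absorbing_cutoff \<Omega> (- 1 / (q - 1)) M (\<lambda>z. V z * u z powr q) \<epsilon> T \<phi>)"
proof -
  define D where "D = \<Omega> \<times> {0::real<..}"
  define \<alpha> where "\<alpha> = 1 / q"
  define \<kappa> where "\<kappa> = - 1 / (q - 1)"
  define p where "p = q / (q - 1)"
  have \<alpha>: "0 \<le> \<alpha>" "\<alpha> < 1" "\<alpha> * q = 1" using q by (auto simp: \<alpha>_def)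
  have u: "u \<in> W12_loc (\<Omega> \<times> {0..})" "u \<in> Lp_loc q (\<Omega> \<times> {0..}) V"
    and upos: "AE z in lebesgue. z \<in> D \<longrightarrow> u z \<ge> 0"
    using sol unfolding weak_solution_def D_def by auto
  have u2: "u \<in> Lp_loc 2 (\<Omega> \<times> {0..}) (\<lambda>_. 1)" using u(1) by (simp add: W12_loc_def)
  have Ds: "D \<in> sets lebesgue" unfolding D_def by (rule open_cylinder_lebesgue[OF \<Omega>(1)])
  have mv: "(\<lambda>z. indicator D z * V z) \<in> borel_measurable lebesgue"
    unfolding D_def using V by (intro measurable_on_open_cylinder[OF \<Omega>]) (auto simp: Lp_loc_def)
  define N where "N = real DIM('a)"
  obtain K where K: "K \<ge> 0" and exg: "\<And>(A::'a set) r. bounded A \<Longrightarrow> r > 0 \<Longrightarrow>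
    (\<exists>g. smooth g \<and> (\<forall>x. 0 \<le> g x \<and> g x \<le> 1) \<and> (\<forall>x\<in>A. g x = 1) \<and>
      (\<forall>x. g x \<noteq> 0 \<longrightarrow> (\<exists>a\<in>A. dist a x < r)) \<and>
      (\<forall>b\<in>Basis. \<forall>x. \<bar>partial b g x\<bar> \<le> K / r * g x powr \<alpha> \<and>
         \<bar>partial b (partial b g) x\<bar> \<le> K / r\<^sup>2 * g x powr \<alpha>))"
    using exists_cutoff[OF \<alpha>(1,2), where 'b='a] by blast
  obtain K' where K': "K' \<ge> 0" and exh: "\<And>(A::real set) r. bounded A \<Longrightarrow> r > 0 \<Longrightarrow>
    (\<exists>g. smooth g \<and> (\<forall>x. 0 \<le> g x \<and> g x \<le> 1) \<and> (\<forall>x\<in>A. g x = 1) \<and>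
      (\<forall>x. g x \<noteq> 0 \<longrightarrow> (\<exists>a\<in>A. dist a x < r)) \<and>
      (\<forall>b\<in>Basis. \<forall>x. \<bar>partial b g x\<bar> \<le> K' / r * g x powr \<alpha> \<and>
         \<bar>partial b (partial b g) x\<bar> \<le> K' / r\<^sup>2 * g x powr \<alpha>))"
    using exists_cutoff[OF \<alpha>(1,2), where 'b=real] by blast
  define c1 where "c1 = 16 * N * K"
  define c2 where "c2 = 4 * K'"
  have c0: "c1 \<ge> 0" "c2 \<ge> 0" using K K' by (auto simp: c1_def c2_def N_def)
  define M where "M = C * (c1 powr p + c2 powr p)"
  show ?thesis
    unfolding \<kappa>_def[symmetric] p_def[symmetric]
  proof (intro exI[of _ M] conjI allI impI)
    show "M \<ge> 0" using C by (simp add: M_def)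
    fix \<epsilon> T :: real
    assume \<epsilon>: "\<epsilon> > 0" and T: "T > 0"
    \<comment> \<open>The margins between 3/4 and the ends 1/2 and 1 leave room for the cutoff to decay and make it constant on a neighbourhood of the inner domain, so that its derivatives vanish there.\<close>
    define A where "A = inner_domain \<Omega> (3 * \<epsilon> / 4)"
    \<comment> \<open>The Laplacian of the cutoff lives on E1 and its time derivative on E2; both sets are disjoint from the inner domain times the first half of the time interval.\<close>
    define E1 where "E1 = (inner_domain \<Omega> (\<epsilon> / 2) - inner_domain \<Omega> \<epsilon>) \<times> {0<..<T}"
    define E2 where "E2 = inner_domain \<Omega> (\<epsilon> / 2) \<times> {T / 2<..<T}"
    define E where "E = D - inner_domain \<Omega> \<epsilon> \<times> {0<..T / 2}"
    assume "(\<integral>\<^sup>+ z \<in> (inner_domain \<Omega> (\<epsilon> / 2) - inner_domain \<Omega> \<epsilon>) \<times> {0<..<T}.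
       ennreal (V z powr \<kappa>) \<partial>lebesgue) \<le> ennreal (C * \<epsilon> powr (2 * q / (q - 1)))"
    then have H1: "(\<integral>\<^sup>+ z \<in> E1. ennreal (V z powr \<kappa>) \<partial>lebesgue) \<le> ennreal (C * \<epsilon> powr (2 * p))"
      by (simp add: E1_def p_def)
    assume "(\<integral>\<^sup>+ z \<in> inner_domain \<Omega> (\<epsilon> / 2) \<times> {T / 2<..<T}.
       ennreal (V z powr \<kappa>) \<partial>lebesgue) \<le> ennreal (C * T powr p)"
    then have H2: "(\<integral>\<^sup>+ z \<in> E2. ennreal (V z powr \<kappa>) \<partial>lebesgue) \<le> ennreal (C * T powr p)"
      by (simp add: E2_def)
    have cin: "compact (inner_domain \<Omega> e)" if "e > 0" for e
      using compact_inner_domain[OF \<Omega>(2) that] .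
    have bin: "inner_domain \<Omega> e \<in> sets borel" if "e > 0" for e
      using cin[OF that] by (rule borel_compact)
    have E1s: "E1 \<in> sets lebesgue" and E2s: "E2 \<in> sets lebesgue"
      unfolding E1_def E2_def using bin \<epsilon> by (auto intro!: borel_product_lebesgue)
    have in\<Omega>: "inner_domain \<Omega> e \<subseteq> \<Omega>" for e by (auto simp: inner_domain_def)
    have E1E: "E1 \<subseteq> E" unfolding E1_def E_def D_def using in\<Omega> by auto
    have E2E: "E2 \<subseteq> E" unfolding E2_def E_def D_def using in\<Omega> T by auto
    have ED: "E \<subseteq> D" by (auto simp: E_def)
    have "bounded A" unfolding A_def using cin \<epsilon> by (intro compact_imp_bounded) auto
    from exg[OF this, of "\<epsilon> / 4"] \<epsilon> obtain g where g: "smooth g \<and> (\<forall>x. 0 \<le> g x \<and> g x \<le> 1) \<and> (\<forall>x\<in>A. g x = 1) \<and>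
      (\<forall>x. g x \<noteq> 0 \<longrightarrow> (\<exists>a\<in>A. dist a x < \<epsilon> / 4)) \<and>
      (\<forall>b\<in>Basis. \<forall>x. \<bar>partial b g x\<bar> \<le> K / (\<epsilon> / 4) * g x powr \<alpha> \<and>
         \<bar>partial b (partial b g) x\<bar> \<le> K / (\<epsilon> / 4)\<^sup>2 * g x powr \<alpha>)" by auto
    note sg = g[THEN conjunct1]
    have g01: "0 \<le> g x" "g x \<le> 1" for x using g by simp_all
    have gA: "g x = 1" if "x \<in> A" for x using g that by simp
    have gs: "g x = 0" if "x \<notin> inner_domain \<Omega> (\<epsilon> / 2)" for x
    proof (rule ccontr)
      assume "g x \<noteq> 0"
      then obtain a where "a \<in> A" "dist a x < \<epsilon> / 4" using g by blast
      then have "x \<in> inner_domain \<Omega> (3 * \<epsilon> / 4 - \<epsilon> / 4)"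
        unfolding A_def using \<epsilon> by (intro inner_domain_thicken) auto
      then show False using that by simp
    qed
    have gd: "\<bar>partial b g x\<bar> \<le> K / (\<epsilon> / 4) * g x powr \<alpha>"
      "\<bar>partial b (partial b g) x\<bar> \<le> K / (\<epsilon> / 4)\<^sup>2 * g x powr \<alpha>" if "b \<in> Basis" for b x
      using g that by blast+
    \<comment> \<open>The time cutoff is built on a symmetric interval: it stays equal to 1 across t = 0, since the initial datum has a favourable sign and needs no cutting off.\<close>
    have "bounded {- (3 * T / 4)..3 * T / 4}" by simp
    from exh[OF this, of "T / 4"] T obtain h where h: "smooth h \<and> (\<forall>x. 0 \<le> h x \<and> h x \<le> 1) \<and>
      (\<forall>x\<in>{- (3 * T / 4)..3 * T / 4}. h x = 1) \<and>
      (\<forall>x. h x \<noteq> 0 \<longrightarrow> (\<exists>a\<in>{- (3 * T / 4)..3 * T / 4}. dist a x < T / 4)) \<and>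
      (\<forall>b\<in>Basis. \<forall>x. \<bar>partial b h x\<bar> \<le> K' / (T / 4) * h x powr \<alpha> \<and>
         \<bar>partial b (partial b h) x\<bar> \<le> K' / (T / 4)\<^sup>2 * h x powr \<alpha>)" by auto
    note sh = h[THEN conjunct1]
    have h01: "0 \<le> h t" "h t \<le> 1" for t using h by simp_all
    have h1: "h t = 1" if "- (3 * T / 4) \<le> t" "t \<le> 3 * T / 4" for t using h that by simp
    have hs: "h t = 0" if "T \<le> t" for t
    proof (rule ccontr)
      assume "h t \<noteq> 0"
      then obtain a where "a \<in> {- (3 * T / 4)..3 * T / 4}" "dist a t < T / 4" using h by blast
      then show False using that by (simp add: dist_real_def)
    qed
    have hd: "\<bar>partial 1 h t\<bar> \<le> K' / (T / 4) * h t powr \<alpha>" for t using h by simp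
    have g2: "partial b (partial b g) x = 0" if "x \<in> inner_domain \<Omega> \<epsilon>" for b x
    proof -
      define U where "U = \<Omega> \<inter> {x. 3 * \<epsilon> / 4 < infdist x (frontier \<Omega>)}"
      have oU: "open U" unfolding U_def by (intro open_Int \<Omega> open_Collect_less continuous_intros)
      have "g y = 1" if "y \<in> U" for y
        by (rule gA) (use that in \<open>auto simp: U_def A_def inner_domain_def\<close>)
      then have "partial b g y = 0" if "y \<in> U" for y by (rule partial_eq_0_on_open[OF oU that])
      moreover have "x \<in> U" using that \<epsilon> by (auto simp: U_def inner_domain_def)
      ultimately show ?thesis by (intro partial_eq_0_on_open[OF oU])
    qed
    have h2: "partial 1 h t = 0" if "0 < t" "t \<le> T / 2" for t
    proof (rule partial_eq_0_on_open[of "{- (3 * T / 4)<..<3 * T / 4}"])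
      show "t \<in> {- (3 * T / 4)<..<3 * T / 4}" using that T by simp
      show "h s = 1" if "s \<in> {- (3 * T / 4)<..<3 * T / 4}" for s using that by (intro h1) auto
    qed simp
    define \<phi> where "\<phi> = (\<lambda>z. g (fst z) * h (snd z))"
    have s\<phi>: "smooth \<phi>" unfolding \<phi>_def by (rule smooth_product[OF sg sh])
    have c\<phi>: "continuous_on UNIV \<phi>" by (rule smooth_continuous[OF s\<phi>])
    have \<phi>01: "0 \<le> \<phi> z" "\<phi> z \<le> 1" for z
      unfolding \<phi>_def using g01 h01 by (auto intro!: mult_le_one)
    define Kx where "Kx = inner_domain \<Omega> (\<epsilon> / 2)"
    have Kx: "compact Kx" "Kx \<subseteq> \<Omega>" unfolding Kx_def using cin[of "\<epsilon> / 2"] \<epsilon> in\<Omega> by auto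
    have gK: "g x = 0" if "x \<notin> Kx" for x using gs that by (simp add: Kx_def)
    define Q where "Q = Kx \<times> {0..T}"
    have Q: "compact Q" "Q \<subseteq> \<Omega> \<times> {0..}" unfolding Q_def using Kx by (auto intro: compact_Times)
    have DQ: "fst z \<notin> Kx \<or> T \<le> snd z" if "z \<in> D - Q" for z
      using that by (cases z) (auto simp: D_def Q_def)
    have pwle: "t powr \<alpha> \<le> 1" if "0 \<le> t" "t \<le> 1" for t using that \<alpha> by (simp add: powr_le1)
    have "\<phi> \<in> lip_test_functions (\<Omega> \<times> {0..})"
      unfolding \<phi>_def
    proof (rule product_in_lip_test_functions[OF sg g01 _ sh h01 _ Kx gK hs])
      show "\<bar>partial b g x\<bar> \<le> K / (\<epsilon> / 4)" if "b \<in> Basis" for b x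
        using order_trans[OF gd(1)[OF that] mult_left_mono[OF pwle[OF g01]]] K \<epsilon> by simp
      show "\<bar>partial 1 h t\<bar> \<le> K' / (T / 4)" for t
        using order_trans[OF hd mult_left_mono[OF pwle[OF h01]]] K' T by simp
    qed
    with sol have weak: "(LINT z:D|lebesgue. V z * u z powr q * \<phi> z)
        \<le> (LINT z:D|lebesgue. fst (weak_grad (\<Omega> \<times> {0..}) u z) \<bullet> grad_x \<phi> z)
          - (LINT z:D|lebesgue. u z * deriv_t \<phi> z) - (LINT x:\<Omega>|lebesgue. u0 x * \<phi> (x, 0))"
      unfolding weak_solution_def D_def by blast
    define L where "L = (\<lambda>z::'a\<times>real. (\<Sum>b\<in>Basis. partial b (partial b g) (fst z)) * h (snd z))"
    define R where "R = (\<lambda>z::'a\<times>real. g (fst z) * partial 1 h (snd z))"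
    have wl: "(LINT z:D|lebesgue. fst (weak_grad (\<Omega> \<times> {0..}) u z) \<bullet> grad_x \<phi> z)
        = - (LINT z:D|lebesgue. u z * L z)"
      unfolding D_def \<phi>_def L_def by (rule weak_laplacian[OF \<Omega>(1) u(1) sg Kx gK sh hs])
    have dt: "deriv_t \<phi> z = R z" for z unfolding \<phi>_def R_def by (rule deriv_t_product[OF sh])
    have "AE x in lebesgue. 0 \<le> indicator \<Omega> x *\<^sub>R (u0 x * \<phi> (x, 0))"
      using u0 by eventually_elim (auto simp: indicator_def \<phi>01)
    then have init: "0 \<le> (LINT x:\<Omega>|lebesgue. u0 x * \<phi> (x, 0))"
      unfolding set_lebesgue_integral_def by (rule integral_nonneg_AE)
    have cpg: "continuous_on UNIV (\<lambda>z::'a\<times>real. f (fst z))" if "smooth f" for f :: "'a \<Rightarrow> real"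
      by (rule continuous_on_compose2[OF smooth_continuous[OF that, of UNIV]]) (auto intro!: continuous_intros)
    have cph: "continuous_on UNIV (\<lambda>z::'a\<times>real. f (snd z))" if "smooth f" for f :: "real \<Rightarrow> real"
      by (rule continuous_on_compose2[OF smooth_continuous[OF that, of UNIV]]) (auto intro!: continuous_intros)
    have sh': "smooth (partial 1 h)" by (rule smooth_partial[OF sh]) simp
    have cL: "continuous_on UNIV L" unfolding L_def
      by (intro continuous_on_mult continuous_on_sum cpg cph sh smooth_partial sg)
    have cR: "continuous_on UNIV R" unfolding R_def
      by (intro continuous_on_mult cpg cph sh' sg)
    have iu: "u absolutely_integrable_on Q" by (rule Lp_loc_2_absolutely_integrable[OF u2 Q])
    define w1 where "w1 = c1 / \<epsilon>\<^sup>2"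
    define w2 where "w2 = c2 / T"
    have w0: "w1 \<ge> 0" "w2 \<ge> 0" using c0 T by (auto simp: w1_def w2_def)
    \<comment> \<open>Where z is outside E1 either g is locally constant or one of the factors vanishes; in the latter case the weight itself is 0.\<close>
    have Lb: "\<bar>L z\<bar> \<le> indicator E1 z * (w1 * \<phi> z powr \<alpha>)" if z: "z \<in> D" for z
    proof -
      have "\<bar>\<Sum>b\<in>Basis. partial b (partial b g) (fst z)\<bar> \<le> (\<Sum>b\<in>(Basis::'a set). K / (\<epsilon> / 4)\<^sup>2 * g (fst z) powr \<alpha>)"
        by (rule order_trans[OF sum_abs]) (intro sum_mono gd(2))
      also have "\<dots> = w1 * g (fst z) powr \<alpha>"
        by (simp add: w1_def c1_def N_def power_divide)
      finally have S: "\<bar>\<Sum>b\<in>Basis. partial b (partial b g) (fst z)\<bar> \<le> w1 * g (fst z) powr \<alpha>" .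
      have hh: "h (snd z) \<le> h (snd z) powr \<alpha>"
        using powr_mono'[of \<alpha> 1 "h (snd z)"] h01[of "snd z"] \<alpha> by simp
      have "\<bar>L z\<bar> = \<bar>\<Sum>b\<in>Basis. partial b (partial b g) (fst z)\<bar> * h (snd z)"
        unfolding L_def using h01(1) by (simp add: abs_mult)
      also have "\<dots> \<le> (w1 * g (fst z) powr \<alpha>) * h (snd z) powr \<alpha>"
        using S hh h01 w0 by (intro mult_mono) auto
      also have "\<dots> = w1 * \<phi> z powr \<alpha>" using g01 h01 by (simp add: \<phi>_def powr_mult)
      finally have b: "\<bar>L z\<bar> \<le> w1 * \<phi> z powr \<alpha>" .
      show ?thesis
      proof (cases "z \<in> E1")
        case False
        have "0 < snd z" using z by (auto simp: D_def)
        then have "fst z \<notin> inner_domain \<Omega> (\<epsilon> / 2) \<or> fst z \<in> inner_domain \<Omega> \<epsilon> \<or> T \<le> snd z"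
          using False unfolding E1_def mem_Times_iff by auto
        then have "L z = 0"
          using b gs[of "fst z"] g2[of "fst z"] hs[of "snd z"] by (auto simp: L_def \<phi>_def)
        then show ?thesis using False by simp
      qed (use b in simp)
    qed
    have Rb: "\<bar>R z\<bar> \<le> indicator E2 z * (w2 * \<phi> z powr \<alpha>)" if z: "z \<in> D" for z
    proof -
      have gg: "g (fst z) \<le> g (fst z) powr \<alpha>"
        using powr_mono'[of \<alpha> 1 "g (fst z)"] g01[of "fst z"] \<alpha> by simp
      have "\<bar>R z\<bar> = g (fst z) * \<bar>partial 1 h (snd z)\<bar>"
        unfolding R_def using g01(1) by (simp add: abs_mult)
      also have "\<dots> \<le> g (fst z) powr \<alpha> * (w2 * h (snd z) powr \<alpha>)"
        using gg hd[of "snd z"] by (intro mult_mono) (auto simp: w2_def c2_def mult.commute)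
      also have "\<dots> = w2 * \<phi> z powr \<alpha>" using g01 h01 by (simp add: \<phi>_def powr_mult)
      finally have b: "\<bar>R z\<bar> \<le> w2 * \<phi> z powr \<alpha>" .
      show ?thesis
      proof (cases "z \<in> E2")
        case False
        have "0 < snd z" using z by (auto simp: D_def)
        moreover have "fst z \<notin> inner_domain \<Omega> (\<epsilon> / 2) \<or> snd z \<le> T / 2 \<or> T \<le> snd z"
          using False unfolding E2_def mem_Times_iff by auto
        ultimately have "R z = 0"
          using b gs[of "fst z"] h2[of "snd z"] hs[of "snd z"] by (auto simp: R_def \<phi>_def)
        then show ?thesis using False by simp
      qed (use b in simp)
    qed
    have iL: "set_integrable lebesgue D (\<lambda>z. u z * L z)"
    proof (rule set_integrable_compact_support[OF iu Q(1) Ds cL])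
      show "L z = 0" if "z \<in> D - Q" for z
        using DQ[OF that] Lb[of z] that gK hs by (auto simp: \<phi>_def indicator_def split: if_splits)
    qed
    have iR: "set_integrable lebesgue D (\<lambda>z. u z * R z)"
    proof (rule set_integrable_compact_support[OF iu Q(1) Ds cR])
      show "R z = 0" if "z \<in> D - Q" for z
        using DQ[OF that] Rb[of z] that gK hs by (auto simp: \<phi>_def indicator_def split: if_splits)
    qed
    define W where "W = (\<lambda>z. V z * u z powr q * \<phi> z)"
    have uQ: "(\<lambda>z. norm (u z) powr q * V z) absolutely_integrable_on Q"
      using u(2) Q unfolding Lp_loc_def by blast
    \<comment> \<open>The local integrability of the energy is stated for the absolute value of u, which agrees with u almost everywhere in D.\<close>
    have iW': "set_integrable lebesgue D (\<lambda>z. (norm (u z) powr q * V z) * \<phi> z)"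
    proof (rule set_integrable_compact_support[OF uQ Q(1) Ds c\<phi>])
      show "\<phi> z = 0" if "z \<in> D - Q" for z
        using DQ[OF that] gK hs by (auto simp: \<phi>_def)
    qed
    have m\<phi>: "\<phi> \<in> borel_measurable lebesgue"
      by (rule measurable_completion) (simp add: borel_measurable_continuous_onI c\<phi>)
    have mW: "(\<lambda>z. indicator D z * W z) \<in> borel_measurable lebesgue"
    proof -
      have "(\<lambda>z. indicator D z * (V z * u z powr q) * \<phi> z) \<in> borel_measurable lebesgue"
        using energy_measurable[OF \<Omega> V u2, folded D_def] m\<phi> by measurable
      then show ?thesis by (simp add: W_def mult.assoc)
    qed
    have iW: "set_integrable lebesgue D W"
      unfolding set_integrable_def
    proof (rule integrable_cong_AE_imp[OF iW'[unfolded set_integrable_def]])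
      show "(\<lambda>z. indicator D z *\<^sub>R W z) \<in> borel_measurable lebesgue" using mW by simp
      show "AE z in lebesgue. indicator D z *\<^sub>R (norm (u z) powr q * V z * \<phi> z) = indicator D z *\<^sub>R W z"
        using upos by eventually_elim (auto simp: W_def indicator_def)
    qed
    have Wpos: "AE z in lebesgue. 0 \<le> indicator D z *\<^sub>R W z"
      using Vpos[folded D_def] by eventually_elim (auto simp: W_def indicator_def \<phi>01 less_imp_le)
    define Y where "Y = (\<integral>\<^sup>+ z \<in> D. ennreal (W z) \<partial>lebesgue)"
    have ind: "ennreal (f z) * indicator S z = ennreal (indicator S z *\<^sub>R f z)" for f and S :: "('a \<times> real) set" and z
      by (auto simp: indicator_def)
    have YX: "Y = ennreal (LINT z:D|lebesgue. W z)"
      unfolding Y_def set_lebesgue_integral_def ind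
      using iW Wpos unfolding set_integrable_def by (rule nn_integral_eq_integral)
    have iF: "integrable lebesgue (\<lambda>z. indicator D z *\<^sub>R (u z * L z + u z * R z))"
      using set_integral_add(1)[OF iL iR] unfolding set_integrable_def .
    have "(LINT z:D|lebesgue. W z) \<le> - (LINT z:D|lebesgue. u z * L z + u z * R z)"
      using weak init unfolding wl dt W_def set_integral_add(2)[OF iL iR] by linarith
    also have "\<dots> \<le> norm (LINT z:D|lebesgue. u z * L z + u z * R z)" by simp
    finally have "Y \<le> ennreal (norm (LINT z:D|lebesgue. u z * L z + u z * R z))"
      unfolding YX by (rule ennreal_leI)
    also have "\<dots> \<le> (\<integral>\<^sup>+ z. norm (indicator D z *\<^sub>R (u z * L z + u z * R z)) \<partial>lebesgue)"
      unfolding set_lebesgue_integral_def by (rule integral_norm_bound_ennreal[OF iF])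
    finally have Yb: "Y \<le> (\<integral>\<^sup>+ z. norm (indicator D z *\<^sub>R (u z * L z + u z * R z)) \<partial>lebesgue)" .
    have mWS: "(\<lambda>z. ennreal (W z) * indicator S z) \<in> borel_measurable lebesgue"
      if "S \<in> sets lebesgue" "S \<subseteq> D" for S
    proof -
      have "(\<lambda>z. ennreal (indicator D z * W z) * indicator S z) \<in> borel_measurable lebesgue"
        using mW that by measurable
      moreover have "(\<lambda>z. ennreal (indicator D z * W z) * indicator S z) = (\<lambda>z. ennreal (W z) * indicator S z)"
        using that by (auto simp: indicator_def fun_eq_iff)
      ultimately show ?thesis by simp
    qed
    have mVS: "(\<lambda>z. ennreal (V z powr \<kappa>) * indicator S z) \<in> borel_measurable lebesgue"
      if "S \<in> sets lebesgue" "S \<subseteq> D" for S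
    proof -
      have "(\<lambda>z. ennreal ((indicator D z * V z) powr \<kappa>) * indicator S z) \<in> borel_measurable lebesgue"
        using mv that by measurable
      moreover have "(\<lambda>z. ennreal ((indicator D z * V z) powr \<kappa>) * indicator S z) = (\<lambda>z. ennreal (V z powr \<kappa>) * indicator S z)"
        using that by (auto simp: indicator_def fun_eq_iff)
      ultimately show ?thesis by simp
    qed
    define P where "P = (\<integral>\<^sup>+ z \<in> E. ennreal (W z) \<partial>lebesgue)"
    \<comment> \<open>Young at each point of E1 and E2 with weight \<mu>; the remaining integrals of the negative power of V are those bounded in the hypotheses, and the powers of \<epsilon> and T cancel.\<close>
    have main: "Y \<le> ennreal (2 * \<mu>) * P + ennreal (M * \<mu> powr \<kappa>)" if \<mu>: "\<mu> > 0" for \<mu>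
    proof -
      define y where "y = (\<lambda>S w z. ennreal \<mu> * (ennreal (W z) * indicator S z)
        + ennreal (\<mu> powr \<kappa> * w powr p) * (ennreal (V z powr \<kappa>) * indicator S z))"
      have young: "ennreal (indicator S z * (w * \<phi> z powr \<alpha>) * \<bar>u z\<bar>) \<le> y S w z"
        if "V z > 0" "u z \<ge> 0" "w \<ge> 0" for S w z
      proof (cases "z \<in> S")
        case True
        have "(u z * \<phi> z powr \<alpha>) * w \<le> (\<mu> * V z) * (u z * \<phi> z powr \<alpha>) powr q + (\<mu> * V z) powr \<kappa> * w powr p"
          unfolding \<kappa>_def p_def using that \<mu> by (intro powr_Young[OF q]) auto
        also have "(u z * \<phi> z powr \<alpha>) powr q = u z powr q * \<phi> z"
          using that \<phi>01[of z] \<alpha>(3) by (simp add: powr_mult powr_powr)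
        also have "(\<mu> * V z) powr \<kappa> = \<mu> powr \<kappa> * V z powr \<kappa>"
          using that \<mu> by (simp add: powr_mult)
        finally have "(w * \<phi> z powr \<alpha>) * \<bar>u z\<bar> \<le> \<mu> * W z + (\<mu> powr \<kappa> * w powr p) * V z powr \<kappa>"
          using that by (simp add: W_def mult_ac)
        then have "ennreal ((w * \<phi> z powr \<alpha>) * \<bar>u z\<bar>) \<le> ennreal (\<mu> * W z + (\<mu> powr \<kappa> * w powr p) * V z powr \<kappa>)"
          by (rule ennreal_leI)
        also have "\<dots> = y S w z"
          using that \<mu> \<phi>01 True by (simp add: y_def W_def ennreal_plus ennreal_mult')
        finally show ?thesis using True by simp
      qed simp
      have "AE z in lebesgue. ennreal (norm (indicator D z *\<^sub>R (u z * L z + u z * R z))) \<le> y E1 w1 z + y E2 w2 z"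
        using Vpos[folded D_def] upos
      proof eventually_elim
        case (elim z)
        show ?case
        proof (cases "z \<in> D")
          case True
          then have Vu: "V z > 0" "u z \<ge> 0" using elim by auto
          have "norm (indicator D z *\<^sub>R (u z * L z + u z * R z)) \<le> \<bar>L z\<bar> * \<bar>u z\<bar> + \<bar>R z\<bar> * \<bar>u z\<bar>"
            using True abs_triangle_ineq[of "u z * L z" "u z * R z"] by (simp add: abs_mult mult.commute)
          also have "\<dots> \<le> indicator E1 z * (w1 * \<phi> z powr \<alpha>) * \<bar>u z\<bar> + indicator E2 z * (w2 * \<phi> z powr \<alpha>) * \<bar>u z\<bar>"
            by (intro add_mono mult_right_mono Lb[OF True] Rb[OF True]) auto
          finally have "ennreal (norm (indicator D z *\<^sub>R (u z * L z + u z * R z)))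
              \<le> ennreal (indicator E1 z * (w1 * \<phi> z powr \<alpha>) * \<bar>u z\<bar> + indicator E2 z * (w2 * \<phi> z powr \<alpha>) * \<bar>u z\<bar>)"
            by (rule ennreal_leI)
          also have "\<dots> = ennreal (indicator E1 z * (w1 * \<phi> z powr \<alpha>) * \<bar>u z\<bar>) + ennreal (indicator E2 z * (w2 * \<phi> z powr \<alpha>) * \<bar>u z\<bar>)"
            using w0 by (intro ennreal_plus) auto
          also have "\<dots> \<le> y E1 w1 z + y E2 w2 z"
            by (intro add_mono young Vu w0)
          finally show ?thesis .
        qed simp
      qed
      then have "Y \<le> (\<integral>\<^sup>+ z. y E1 w1 z + y E2 w2 z \<partial>lebesgue)"
        by (intro order_trans[OF Yb] nn_integral_mono_AE)
      also have my: "y S w \<in> borel_measurable lebesgue" if "S \<in> sets lebesgue" "S \<subseteq> D" for S w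
        unfolding y_def using mWS[OF that] mVS[OF that] by measurable
      have iy: "(\<integral>\<^sup>+ z. y S w z \<partial>lebesgue) = ennreal \<mu> * (\<integral>\<^sup>+ z \<in> S. ennreal (W z) \<partial>lebesgue)
          + ennreal (\<mu> powr \<kappa> * w powr p) * (\<integral>\<^sup>+ z \<in> S. ennreal (V z powr \<kappa>) \<partial>lebesgue)"
        if "S \<in> sets lebesgue" "S \<subseteq> D" for S w
        unfolding y_def using mWS[OF that] mVS[OF that]
        by (simp add: nn_integral_add nn_integral_cmult)
      have ES: "E1 \<subseteq> D" "E2 \<subseteq> D" using E1E E2E ED by auto
      have "(\<integral>\<^sup>+ z. y E1 w1 z + y E2 w2 z \<partial>lebesgue) = (\<integral>\<^sup>+ z. y E1 w1 z \<partial>lebesgue) + (\<integral>\<^sup>+ z. y E2 w2 z \<partial>lebesgue)"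
        using my[OF E1s ES(1)] my[OF E2s ES(2)] by (rule nn_integral_add)
      also have "\<dots> \<le> (ennreal \<mu> * P + ennreal (\<mu> powr \<kappa> * w1 powr p) * ennreal (C * \<epsilon> powr (2 * p)))
          + (ennreal \<mu> * P + ennreal (\<mu> powr \<kappa> * w2 powr p) * ennreal (C * T powr p))"
        unfolding iy[OF E1s ES(1)] iy[OF E2s ES(2)] P_def
        by (intro add_mono mult_left_mono H1 H2 nn_set_integral_set_mono E1E E2E zero_le)
      also have "\<dots> = ennreal (2 * \<mu>) * P + ennreal (M * \<mu> powr \<kappa>)"
      proof -
        have "ennreal (\<mu> powr \<kappa> * w1 powr p) * ennreal (C * \<epsilon> powr (2 * p)) = ennreal (\<mu> powr \<kappa> * (C * c1 powr p))"
        proof -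
          have "w1 powr p * \<epsilon> powr (2 * p) = c1 powr p"
          proof -
            have "w1 powr p = c1 powr p / (\<epsilon>\<^sup>2) powr p"
              unfolding w1_def by (rule powr_divide)
            also have "(\<epsilon>\<^sup>2) powr p = \<epsilon> powr (2 * p)"
              using \<epsilon> by (simp add: powr_powr flip: powr_numeral)
            finally show ?thesis using \<epsilon> by simp
          qed
          then show ?thesis using C by (simp add: ennreal_mult'[symmetric] mult_ac)
        qed
        moreover have "ennreal (\<mu> powr \<kappa> * w2 powr p) * ennreal (C * T powr p) = ennreal (\<mu> powr \<kappa> * (C * c2 powr p))"
        proof -
          have "w2 powr p * T powr p = c2 powr p"
            unfolding w2_def using c0 T by (simp add: powr_divide)
          then show ?thesis using C by (simp add: ennreal_mult'[symmetric] mult_ac)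
        qed
        moreover have "ennreal (M * \<mu> powr \<kappa>) = ennreal (\<mu> powr \<kappa> * (C * c1 powr p)) + ennreal (\<mu> powr \<kappa> * (C * c2 powr p))"
          using C by (simp add: M_def algebra_simps flip: ennreal_plus)
        moreover have "ennreal (2 * \<mu>) * P = ennreal \<mu> * P + ennreal \<mu> * P"
        proof -
          have "ennreal (2 * \<mu>) = ennreal \<mu> + ennreal \<mu>"
            using \<mu> by (subst ennreal_plus[symmetric]) auto
          then show ?thesis by (simp only: distrib_right)
        qed
        ultimately show ?thesis by (simp only: add_ac)
      qed
      finally show ?thesis .
    qed
    show "\<exists>\<phi>. absorbing_cutoff \<Omega> \<kappa> M (\<lambda>z. V z * u z powr q) \<epsilon> T \<phi>"
      unfolding absorbing_cutoff_def D_def[symmetric]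
    proof (intro exI[of _ \<phi>] conjI allI ballI impI)
      show "continuous_on UNIV \<phi>" "0 \<le> \<phi> z" "\<phi> z \<le> 1" for z by (rule c\<phi> \<phi>01)+
      show "\<phi> z = 1" if "z \<in> inner_domain \<Omega> \<epsilon> \<times> {0<..T / 2}" for z
        using that gA[of "fst z"] h1[of "snd z"] inner_domain_antimono[of "3 * \<epsilon> / 4" \<epsilon> \<Omega>] \<epsilon> T
        unfolding \<phi>_def A_def by (cases z) auto
      show "(\<integral>\<^sup>+ z \<in> D. ennreal (V z * u z powr q * \<phi> z) \<partial>lebesgue) < \<infinity>"
        using YX unfolding Y_def W_def by simp
      show "(\<integral>\<^sup>+ z \<in> D. ennreal (V z * u z powr q * \<phi> z) \<partial>lebesgue)
        \<le> ennreal (2 * \<mu>) * (\<integral>\<^sup>+ z \<in> D - inner_domain \<Omega> \<epsilon> \<times> {0<..T / 2}.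
              ennreal (V z * u z powr q * \<phi> z) \<partial>lebesgue) + ennreal (M * \<mu> powr \<kappa>)" if "\<mu> > 0" for \<mu>
        using main[OF that] unfolding Y_def P_def W_def E_def .
    qed
  qed
qed

section \<open>Exhaustion of the cylinder and the Liouville theorem\<close>

text \<open>Along cutoffs that exhaust the cylinder the estimate is used twice. With a small fixed
  weight it bounds the localised energies, and Fatou's lemma makes the total energy finite. Then the
  energy outside the exhausting sets tends to 0 by dominated convergence, so only the term
  \<open>M * \<mu> powr \<kappa>\<close> survives in the limit, and it tends to 0 for large \<open>\<mu>\<close>.\<close>

lemma vanishing_from_estimate:
  fixes \<Omega> :: "'a::euclidean_space set" and w :: "'a \<times> real \<Rightarrow> real" and \<phi> :: "nat \<Rightarrow> 'a \<times> real \<Rightarrow> real"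
    and e T :: "nat \<Rightarrow> real"
  assumes \<Omega>: "open \<Omega>" "bounded \<Omega>" and \<kappa>: "\<kappa> < 0" and M: "M \<ge> 0"
    and w: "(\<lambda>z. indicator (\<Omega> \<times> {0<..}) z * w z) \<in> borel_measurable lebesgue"
    and wpos: "AE z in lebesgue. z \<in> \<Omega> \<times> {0<..} \<longrightarrow> w z \<ge> 0"
    and e: "e \<longlonglongrightarrow> 0" and T: "filterlim T at_top sequentially"
    and cut: "\<And>n. absorbing_cutoff \<Omega> \<kappa> M w (e n) (T n) (\<phi> n)"
    and epos: "\<And>n. e n > 0"
  shows "AE z in lebesgue. z \<in> \<Omega> \<times> {0<..} \<longrightarrow> w z = 0"
proof -
  define D where "D = \<Omega> \<times> {0::real<..}"
  define G where "G = (\<lambda>n. inner_domain \<Omega> (e n) \<times> {0<..T n / 2})"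
  define J where "J = (\<lambda>n. \<integral>\<^sup>+ z \<in> D. ennreal (w z * \<phi> n z) \<partial>lebesgue)"
  define P where "P = (\<lambda>n. \<integral>\<^sup>+ z \<in> D - G n. ennreal (w z * \<phi> n z) \<partial>lebesgue)"
  define Z where "Z = (\<lambda>n. \<integral>\<^sup>+ z \<in> D - G n. ennreal (w z) \<partial>lebesgue)"
  define I where "I = (\<integral>\<^sup>+ z \<in> D. ennreal (w z) \<partial>lebesgue)"
  note w = w[folded D_def] and wpos = wpos[folded D_def]
  have \<phi>: "continuous_on UNIV (\<phi> n)" "0 \<le> \<phi> n z" "\<phi> n z \<le> 1"
    and \<phi>1: "z \<in> G n \<Longrightarrow> \<phi> n z = 1" and fin: "J n < \<infinity>" for n z
    using cut[of n] unfolding absorbing_cutoff_def J_def D_def G_def by blast+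
  have est: "J n \<le> ennreal (2 * \<mu>) * P n + ennreal (M * \<mu> powr \<kappa>)" if "\<mu> > 0" for n \<mu>
    using cut[of n] that unfolding absorbing_cutoff_def J_def P_def D_def G_def by blast
  have Gs: "G n \<in> sets lebesgue" for n
    unfolding G_def using compact_inner_domain[OF \<Omega>(2) epos]
    by (intro borel_product_lebesgue) (auto intro: borel_compact)
  have PJ: "P n \<le> J n" for n unfolding P_def J_def by (intro nn_set_integral_set_mono) auto
  have PZ: "P n \<le> Z n" for n
    unfolding P_def Z_def
  proof (rule nn_integral_mono_AE)
    show "AE z in lebesgue. ennreal (w z * \<phi> n z) * indicator (D - G n) z \<le> ennreal (w z) * indicator (D - G n) z"
      using wpos
    proof eventually_elim
      case (elim z)
      have "w z * \<phi> n z \<le> w z" if "z \<in> D" using elim that \<phi>(2,3)[of n z] by (simp add: mult_left_le)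
      then show ?case by (auto simp: indicator_def intro!: ennreal_leI)
    qed
  qed
  have evG: "\<forall>\<^sub>F n in sequentially. z \<in> G n" if "z \<in> D" for z
  proof -
    have "fst z \<in> \<Omega>" using \<open>z \<in> D\<close> by (auto simp: D_def)
    then obtain d where d: "d > 0" "fst z \<in> inner_domain \<Omega> d"
      by (rule inner_domain_exhaust[OF \<Omega>])
    have "\<forall>\<^sub>F n in sequentially. e n < d" using order_tendstoD(2)[OF e d(1)] .
    moreover have "\<forall>\<^sub>F n in sequentially. 2 * snd z < T n" using T by (simp add: filterlim_at_top_dense)
    ultimately show ?thesis
    proof eventually_elim
      case (elim n)
      then show ?case using d(2) \<open>z \<in> D\<close> inner_domain_antimono[of "e n" d \<Omega>]
        unfolding G_def D_def mem_Times_iff by auto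
    qed
  qed
  have m\<phi>: "\<phi> n \<in> borel_measurable lebesgue" for n
    by (rule measurable_completion) (simp add: borel_measurable_continuous_onI \<phi>(1))
  have ind: "ennreal (f z) * indicator S z = ennreal (indicator S z * f z)" for f and S :: "('a \<times> real) set" and z
    by (auto simp: indicator_def)
  have mwS: "(\<lambda>z. ennreal (w z) * indicator D z) \<in> borel_measurable lebesgue"
    unfolding ind using w by measurable
  have m1: "(\<lambda>z. ennreal (w z * \<phi> n z) * indicator D z) \<in> borel_measurable lebesgue" for n
  proof -
    have "(\<lambda>z. ennreal ((indicator D z * w z) * \<phi> n z)) \<in> borel_measurable lebesgue" using w m\<phi> by measurable
    then show ?thesis unfolding ind[of "\<lambda>z. w z * \<phi> n z"] by (simp only: mult.assoc)
  qed
  have m2: "(\<lambda>z. ennreal (w z) * indicator (D - G n) z) \<in> borel_measurable lebesgue" for n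
  proof -
    have "(\<lambda>z. (ennreal (w z) * indicator D z) * indicator (- G n) z) \<in> borel_measurable lebesgue"
      using mwS Gs[of n] by measurable
    moreover have "(ennreal (w z) * indicator D z) * indicator (- G n) z = ennreal (w z) * indicator (D - G n) z" for z
      by (auto simp: indicator_def)
    ultimately show ?thesis by simp
  qed
  have fatou: "I \<le> liminf J"
  proof -
    have "ennreal (w z) * indicator D z = liminf (\<lambda>n. ennreal (w z * \<phi> n z) * indicator D z)" for z
    proof (cases "z \<in> D")
      case True
      from evG[OF True] have "\<forall>\<^sub>F n in sequentially. ennreal (w z) * indicator D z = ennreal (w z * \<phi> n z) * indicator D z"
        by eventually_elim (simp add: \<phi>1)
      then have "(\<lambda>n. ennreal (w z * \<phi> n z) * indicator D z) \<longlonglongrightarrow> ennreal (w z) * indicator D z"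
        by (rule Lim_transform_eventually[OF tendsto_const])
      then show ?thesis by (intro lim_imp_Liminf[symmetric]) auto
    qed (simp add: Liminf_const)
    then show ?thesis unfolding I_def J_def using nn_integral_liminf[OF m1] by simp
  qed
  have Ib: "I \<le> ennreal c" if "\<forall>\<^sub>F n in sequentially. J n \<le> ennreal c" for c
    using fatou Liminf_le[OF _ that] by (rule order_trans) simp
  \<comment> \<open>The weight 1/4 gives the factor 1/2, so that the energy on the right can be absorbed on the left; this uses that each localised energy is finite.\<close>
  define b where "b = M * (1 / 4) powr \<kappa>"
  have b: "b \<ge> 0" using M by (simp add: b_def)
  have "J n \<le> ennreal (2 * b)" for n
  proof -
    obtain j where j: "J n = ennreal j" "j \<ge> 0" using fin[of n] by (cases "J n") auto
    have "J n \<le> ennreal (1 / 2) * P n + ennreal b" using est[of "1 / 4" n] by (simp add: b_def)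
    also have "\<dots> \<le> ennreal (1 / 2) * J n + ennreal b" by (intro add_right_mono mult_left_mono PJ) simp
    also have "\<dots> = ennreal (1 / 2 * j) + ennreal b"
      unfolding j(1) using j(2) by (intro arg_cong2[where f="(+)"] ennreal_mult[symmetric] refl) auto
    also have "\<dots> = ennreal (1 / 2 * j + b)" using j b by (intro ennreal_plus[symmetric]) auto
    finally have "ennreal j \<le> ennreal (1 / 2 * j + b)" unfolding j(1) .
    then have "j \<le> 1 / 2 * j + b" using j(2) b by (subst (asm) ennreal_le_iff) auto
    then show ?thesis using j by (simp add: ennreal_leI)
  qed
  then have If: "I < \<infinity>" using Ib[of "2 * b"] by (auto intro: le_less_trans)
  have Z0: "Z \<longlonglongrightarrow> 0"
  proof -
    have "(\<lambda>n. \<integral>\<^sup>+ z. ennreal (w z) * indicator (D - G n) z \<partial>lebesgue) \<longlonglongrightarrow> (\<integral>\<^sup>+ z. (0::ennreal) \<partial>(lebesgue :: ('a \<times> real) measure))"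
    proof (rule nn_integral_dominated_convergence[where w="\<lambda>z. ennreal (w z) * indicator D z"])
      show "(\<lambda>z. ennreal (w z) * indicator D z) \<in> borel_measurable lebesgue" by (rule mwS)
      show "(\<integral>\<^sup>+ z. ennreal (w z) * indicator D z \<partial>lebesgue) < \<infinity>" using If by (simp add: I_def)
      show "AE z in lebesgue. ennreal (w z) * indicator (D - G n) z \<le> ennreal (w z) * indicator D z" for n
        by (intro always_eventually allI mult_left_mono) (auto simp: indicator_def)
      show "AE z in lebesgue. (\<lambda>n. ennreal (w z) * indicator (D - G n) z) \<longlonglongrightarrow> 0"
      proof (intro always_eventually allI)
        fix z
        have "\<forall>\<^sub>F n in sequentially. 0 = ennreal (w z) * indicator (D - G n) z"
        proof (cases "z \<in> D")
          case True
          from evG[OF this] show ?thesis by eventually_elim simp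
        qed simp
        then show "(\<lambda>n. ennreal (w z) * indicator (D - G n) z) \<longlonglongrightarrow> 0"
          by (rule Lim_transform_eventually[OF tendsto_const])
      qed
    qed (use m2 in auto)
    then show ?thesis by (simp add: Z_def)
  qed
  have "I \<le> ennreal \<delta>" if "\<delta> > 0" for \<delta>
  proof -
    \<comment> \<open>The order of the limits matters: \<mu> is fixed, large, before n tends to infinity.\<close>
    have "((\<lambda>\<mu>. M * \<mu> powr \<kappa>) \<longlongrightarrow> M * 0) at_top"
      by (intro tendsto_mult tendsto_const tendsto_neg_powr[OF \<kappa>] filterlim_ident)
    then have "\<forall>\<^sub>F \<mu> in at_top. M * \<mu> powr \<kappa> < \<delta> / 2"
      using that by (intro order_tendstoD(2)[where y="M * 0"]) auto
    from eventually_conj[OF this eventually_gt_at_top[of 0]]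
    obtain \<mu> :: real where \<mu>: "M * \<mu> powr \<kappa> < \<delta> / 2" "\<mu> > 0"
      using eventually_happens' trivial_limit_at_top_linorder by blast
    have "\<forall>\<^sub>F n in sequentially. Z n < ennreal (\<delta> / (4 * \<mu>))"
      using Z0 \<mu>(2) that by (intro order_tendstoD(2)) auto
    then have "\<forall>\<^sub>F n in sequentially. J n \<le> ennreal \<delta>"
    proof eventually_elim
      case (elim n)
      have "J n \<le> ennreal (2 * \<mu>) * P n + ennreal (M * \<mu> powr \<kappa>)" by (rule est[OF \<mu>(2)])
      also have "\<dots> \<le> ennreal (2 * \<mu>) * ennreal (\<delta> / (4 * \<mu>)) + ennreal (\<delta> / 2)"
        using order_trans[OF PZ less_imp_le[OF elim]] \<mu>(1) by (intro add_mono mult_left_mono ennreal_leI) auto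
      also have "\<dots> = ennreal (2 * \<mu> * (\<delta> / (4 * \<mu>))) + ennreal (\<delta> / 2)"
        using \<mu>(2) that by (intro arg_cong2[where f="(+)"] ennreal_mult[symmetric] refl) auto
      also have "\<dots> = ennreal (2 * \<mu> * (\<delta> / (4 * \<mu>)) + \<delta> / 2)"
        using \<mu>(2) that by (intro ennreal_plus[symmetric]) auto
      also have "2 * \<mu> * (\<delta> / (4 * \<mu>)) + \<delta> / 2 = \<delta>" using \<mu>(2) by simp
      finally show ?case .
    qed
    then show ?thesis by (rule Ib)
  qed
  then have "I = 0" by (metis ennreal_le_epsilon add_0 le_zero_eq)
  then have "AE z in lebesgue. ennreal (w z) * indicator D z = 0"
    unfolding I_def using nn_integral_0_iff_AE[OF mwS] by simp
  then show ?thesis unfolding D_def[symmetric]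
    using wpos by eventually_elim (auto simp: indicator_def ennreal_eq_0_iff)
qed

theorem theorem2p6:
  fixes \<Omega> :: "(real ^ 'n) set" and q \<epsilon>0 C :: real
    and V u :: "(real ^ 'n) \<times> real \<Rightarrow> real" and u0 :: "real ^ 'n \<Rightarrow> real"
    and f :: "real \<Rightarrow> real"
  assumes "CARD('n) \<ge> 3"
    and "open \<Omega>" and "bounded \<Omega>" and "connected \<Omega>"
    and "q > 1"
    and "V \<in> Lp_loc 1 (\<Omega> \<times> {0..}) (\<lambda>_. 1)"
    and "AE z in lebesgue. z \<in> \<Omega> \<times> {0<..} \<longrightarrow> V z > 0"
    and "u0 \<in> Lp_loc 1 \<Omega> (\<lambda>_. 1)"
    and "AE x in lebesgue. x \<in> \<Omega> \<longrightarrow> u0 x \<ge> 0"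
    and "\<epsilon>0 > 0"
    and "\<And>\<epsilon>. \<epsilon> \<in> {0<..<\<epsilon>0} \<Longrightarrow> f \<epsilon> \<ge> 1"
    and "\<And>\<epsilon> \<epsilon>'. 0 < \<epsilon> \<Longrightarrow> \<epsilon> \<le> \<epsilon>' \<Longrightarrow> \<epsilon>' < \<epsilon>0 \<Longrightarrow> f \<epsilon>' \<le> f \<epsilon>"
    and "filterlim f at_top (at_right 0)"
    and "C > 0"
    and "\<forall>\<^sub>F \<epsilon> in at_right 0.
           (\<integral>\<^sup>+ z \<in> (inner_domain \<Omega> (\<epsilon> / 2) - inner_domain \<Omega> \<epsilon>) \<times> {0<..<f \<epsilon>}.
              ennreal (V z powr (- 1 / (q - 1))) \<partial>lebesgue)
           \<le> ennreal (C * \<epsilon> powr (2 * q / (q - 1)))"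
    and "\<forall>\<^sub>F \<epsilon> in at_right 0.
           (\<integral>\<^sup>+ z \<in> inner_domain \<Omega> (\<epsilon> / 2) \<times> {f \<epsilon> / 2<..<f \<epsilon>}.
              ennreal (V z powr (- 1 / (q - 1))) \<partial>lebesgue)
           \<le> ennreal (C * f \<epsilon> powr (q / (q - 1)))"
    and "weak_solution \<Omega> q V u0 u"
  shows "AE z in lebesgue. z \<in> \<Omega> \<times> {0<..} \<longrightarrow> u z = 0"
proof -
  note \<Omega> = assms(2,3) and q = assms(5) and V = assms(6) and Vpos = assms(7)
    and flim = assms(13) and sol = assms(17)
  define cond1 where "cond1 = (\<lambda>\<epsilon> T. (\<integral>\<^sup>+ z \<in> (inner_domain \<Omega> (\<epsilon> / 2) - inner_domain \<Omega> \<epsilon>) \<times> {0<..<T}.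
      ennreal (V z powr (- 1 / (q - 1))) \<partial>lebesgue) \<le> ennreal (C * \<epsilon> powr (2 * q / (q - 1))))"
  define cond2 where "cond2 = (\<lambda>\<epsilon> T. (\<integral>\<^sup>+ z \<in> inner_domain \<Omega> (\<epsilon> / 2) \<times> {T / 2<..<T}.
      ennreal (V z powr (- 1 / (q - 1))) \<partial>lebesgue) \<le> ennreal (C * T powr (q / (q - 1))))"
  define good where "good = (\<lambda>M \<epsilon> T \<phi>.
      absorbing_cutoff \<Omega> (- 1 / (q - 1)) M (\<lambda>z. V z * u z powr q) \<epsilon> T \<phi>)"
  have "\<exists>M\<ge>0. \<forall>\<epsilon>>0. \<forall>T>0. cond1 \<epsilon> T \<longrightarrow> cond2 \<epsilon> T \<longrightarrow> (\<exists>\<phi>. good M \<epsilon> T \<phi>)"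
    unfolding cond1_def cond2_def good_def
    by (rule test_function_estimate[OF \<Omega> q assms(14) V Vpos assms(9) sol])
  then obtain M where M: "M \<ge> 0"
    and ex: "\<And>\<epsilon> T. \<epsilon> > 0 \<Longrightarrow> T > 0 \<Longrightarrow> cond1 \<epsilon> T \<Longrightarrow> cond2 \<epsilon> T \<Longrightarrow> \<exists>\<phi>. good M \<epsilon> T \<phi>"
    by blast
  have "\<forall>\<^sub>F \<epsilon> in at_right 0. f \<epsilon> > 0" using flim by (simp add: filterlim_at_top_dense)
  moreover have "\<forall>\<^sub>F \<epsilon> in at_right 0. cond1 \<epsilon> (f \<epsilon>)" unfolding cond1_def by (rule assms(15))
  moreover have "\<forall>\<^sub>F \<epsilon> in at_right 0. cond2 \<epsilon> (f \<epsilon>)" unfolding cond2_def by (rule assms(16))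
  ultimately have "\<forall>\<^sub>F \<epsilon> in at_right 0. \<epsilon> > 0 \<and> f \<epsilon> > 0 \<and> cond1 \<epsilon> (f \<epsilon>) \<and> cond2 \<epsilon> (f \<epsilon>)"
    by (intro eventually_conj eventually_at_right_less)
  then have ev: "\<forall>\<^sub>F \<epsilon> in at_right 0. \<epsilon> > 0 \<and> (\<exists>\<phi>. good M \<epsilon> (f \<epsilon>) \<phi>)"
    by eventually_elim (use ex in blast)
  \<comment> \<open>The hypotheses hold for small \<epsilon> only, so the sequence 1 / (n + 1) is shifted until they hold for all of its members.\<close>
  define s where "s = (\<lambda>n. inverse (real (Suc n)))"
  have s0: "filterlim s (at_right 0) sequentially"
    unfolding s_def by (intro tendsto_imp_filterlim_at_right LIMSEQ_inverse_real_of_nat) simp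
  obtain N where N: "\<And>n. n \<ge> N \<Longrightarrow> \<exists>\<phi>. good M (s n) (f (s n)) \<phi>"
    using eventually_compose_filterlim[OF ev s0] unfolding eventually_sequentially by blast
  define e where "e = (\<lambda>n. s (n + N))"
  have e0: "filterlim e (at_right 0) sequentially"
    unfolding e_def using filterlim_compose[OF s0 filterlim_add_const_nat_at_top] .
  have "\<forall>n. \<exists>\<phi>. good M (e n) (f (e n)) \<phi>" using N by (simp add: e_def)
  then obtain \<phi> where \<phi>: "\<And>n. good M (e n) (f (e n)) (\<phi> n)" by metis
  have u: "u \<in> Lp_loc 2 (\<Omega> \<times> {0..}) (\<lambda>_. 1)"
    using sol unfolding weak_solution_def W12_loc_def by auto
  have "AE z in lebesgue. z \<in> \<Omega> \<times> {0<..} \<longrightarrow> V z * u z powr q = 0"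
  proof (rule vanishing_from_estimate[where \<phi>=\<phi> and e=e and T="\<lambda>n. f (e n)", OF \<Omega> _ M])
    show "- 1 / (q - 1) < 0" using q by simp
    show "(\<lambda>z. indicator (\<Omega> \<times> {0<..}) z * (V z * u z powr q)) \<in> borel_measurable lebesgue"
      by (rule energy_measurable[OF \<Omega> V u])
    show "AE z in lebesgue. z \<in> \<Omega> \<times> {0<..} \<longrightarrow> 0 \<le> V z * u z powr q"
      using Vpos by eventually_elim (auto intro: less_imp_le)
    show "e \<longlonglongrightarrow> 0" using e0 by (simp add: filterlim_at)
    show "filterlim (\<lambda>n. f (e n)) at_top sequentially" by (rule filterlim_compose[OF flim e0])
    show "e n > 0" for n by (simp add: e_def s_def)
    show "absorbing_cutoff \<Omega> (- 1 / (q - 1)) M (\<lambda>z. V z * u z powr q) (e n) (f (e n)) (\<phi> n)" for n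
      using \<phi>[of n] by (simp only: good_def)
  qed
  then show ?thesis
    using Vpos by eventually_elim auto
qed

end
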